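(* For integers $n\ge k\ge0$, the map $\Phi_{n,k}:\Pi_{n+1,n-k+1}\to\mathsf{P}_{n,k}$ sending $\pi$ to the unique path $\mathcal{P}\in\mathsf{P}_{n,k}$ with $\mathrm{wt}(\mathcal{P})=W(\pi)$ is a bijection.
   Context: $\Pi_{m,r}$ is the set of partitions of $[m]$ into exactly $r$ nonempty blocks; $\mathrm{smallest}(\pi,i)$ is the smallest element of the block of $\pi$ containing $i$; $B_1$ is the block containing $1$. For $\pi\in\Pi_{n+1,n-k+1}$ define a total order on $[n+1]$: take $B_1$ together with the largest elements of all other blocks, in increasing order; then insert the remaining elements of each block $B\ne B_1$, in increasing order, immediately before the largest element of $B$. Write it as $1\,p_1\cdots p_n$. Let $\mathrm{largest}(\mathbf{p},i)_j$ be the $j$-th largest element of $[2,n+1]\setminus\{p_i,\dots,p_n\}$. Set $l_n=0$ and for $2\le i\le n$, $l_{i-1}=l_i$ if $\mathrm{smallest}(\pi,p_i)=p_i$, else $l_{i-1}=l_i+1$. Define $W(\pi)=w_n\cdots w_1$ with $w_i=e_{i-1,l_i}$ if $\mathrm{smallest}(\pi,p_i)=p_i$; $w_i=a_{i-1,0,l_i}$ if $p_i\in B_1$; $w_i=a_{i-1,j,l_i}$ if $\mathrm{smallest}(\pi,p_i)\ne1,p_i$ and $\mathrm{largest}(\mathbf{p},i)_j=p_{i-1}$. Symbols $\mathcal{A}=\{a_{i,j,l}:j\le i\}$, $\mathcal{E}=\{e_{i,l}\}$ with nonnegative integer indices. Planar network $D'$: let $\Delta(n)=\binom{n+1}{2}$,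 $\Delta^{-1}(t)$ the $n$ with $\Delta(n)=t$ for triangular $t$, $\lceil m\rceil_\Delta$ the smallest triangular number $\ge m$, $\delta(m)=\lceil m\rceil_\Delta-m$. On vertices $\{(i,j):0\le i\le j\}$, for $1\le i\le j$ put a horizontal edge $(i,j)\to(i-1,j)$ of weight $\alpha_{i,j-i+1}$ and a diagonal edge $(i,j)\to(i-1,j-1)$ of weight $\beta_{i,j-i}$, where for $i\ge1,l\ge0$: $\beta_{i,l}=e_{\Delta^{-1}(i+l-1)-l,\,l}$ if $i+l-1$ is triangular and $\ge\Delta(l)$, $\beta_{i,l}=1$ if $i+l-1$ is not triangular and $\ge\Delta(l)$, else $0$; and for $i,l\ge1$: $\alpha_{i,l}=a_{\Delta^{-1}(\lceil i+l-1\rceil_\Delta)-l,\ \delta(i+l-1),\ l-1}$ if $\Delta^{-1}(\lceil i+l-1\rceil_\Delta)-l\ge\delta(i+l-1)$, otherwise $1$ if $i+l-1$ is triangular and $<\Delta(l)$, else $0$. Delete weight-$0$ edges. Sources $u_n=(\Delta(n),\Delta(n))$, sinks $v_k=(0,\Delta(k))$; $\mathsf{P}_{n,k}$ is the set of paths from $u_n$ to $v_k$; $\mathrm{wt}(\mathcal{P})$ is the word of the non-$1$ edge weights along $\mathcal{P}$ in order of traversal. For each $\pi\in\Pi_{n+1,n-k+1}$ there is exactly one $\mathcal{P}\in\mathsf{P}_{n,k}$ with $\mathrm{wt}(\mathcal{P})=W(\pi)$, so $\Phi_{n,k}$ is well defined. *)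

theory Defs
  imports
    "HOL-Library.Disjoint_Sets"
    "Graph_Theory.Graph_Theory"
begin

definition Partitions :: "nat \<Rightarrow> nat \<Rightarrow> nat set set set" where
  "Partitions m r = {\<pi>. partition_on {1..m} \<pi> \<and> card \<pi> = r}"

definition block :: "nat set set \<Rightarrow> nat \<Rightarrow> nat set" where
  "block \<pi> i = (THE B. B \<in> \<pi> \<and> i \<in> B)"

definition smallest :: "nat set set \<Rightarrow> nat \<Rightarrow> nat" where
  "smallest \<pi> i = Min (block \<pi> i)"

text \<open>
  The total order on \<open>{1..n+1}\<close> attached to a partition, written as the list
  \<open>[1, p\<^sub>1, \<dots>, p\<^sub>n]\<close>.  The elements of the block of 1 and the maxima of the other blocks
  are listed increasingly; the maximum of a block \<open>B\<close> not containing 1 is then expanded into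
  the increasing list of the remaining elements of \<open>B\<close> followed by that maximum.
\<close>

definition order_skeleton :: "nat set set \<Rightarrow> nat list" where
  "order_skeleton \<pi> = sorted_list_of_set (block \<pi> 1 \<union> Max ` (\<pi> - {block \<pi> 1}))"

definition order_word :: "nat set set \<Rightarrow> nat list" where
  "order_word \<pi> =
     concat (map (\<lambda>x. if x \<in> block \<pi> 1 then [x]
                       else sorted_list_of_set (block \<pi> x - {x}) @ [x])
                 (order_skeleton \<pi>))"

text \<open>\<open>order_elem \<pi> i\<close> is \<open>p\<^sub>i\<close> for \<open>1 \<le> i \<le> n\<close>; at \<open>i = 0\<close> it is the initial 1.\<close>

definition order_elem :: "nat set set \<Rightarrow> nat \<Rightarrow> nat" where
  "order_elem \<pi> i = order_word \<pi> ! i"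

text \<open>Here \<open>j\<close> counts from 1, so \<open>j = 1\<close> gives the maximum.\<close>

definition largest :: "nat \<Rightarrow> nat set set \<Rightarrow> nat \<Rightarrow> nat \<Rightarrow> nat" where
  "largest n \<pi> i j =
     rev (sorted_list_of_set ({2..n+1} - order_elem \<pi> ` {i..n})) ! (j - 1)"

text \<open>\<open>level n \<pi> i\<close> is \<open>l\<^sub>i\<close>; only the values for \<open>1 \<le> i \<le> n\<close> are meaningful.\<close>

function level :: "nat \<Rightarrow> nat set set \<Rightarrow> nat \<Rightarrow> nat" where
  "level n \<pi> i =
     (if i \<ge> n then 0
      else if smallest \<pi> (order_elem \<pi> (i + 1)) = order_elem \<pi> (i + 1)
           then level n \<pi> (i + 1)
           else level n \<pi> (i + 1) + 1)"
  by pat_completeness auto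
termination by (relation "measure (\<lambda>(n, \<pi>, i). n - i)") auto

declare level.simps [simp del]

text \<open>
  \<open>A i j l\<close> is the symbol \<open>a\<^bsub>i,j,l\<^esub>\<close> and \<open>E i l\<close> is \<open>e\<^bsub>i,l\<^esub>\<close>.  Symbols \<open>A i j l\<close> with
  \<open>j > i\<close> are not part of the alphabet; they occur in none of the words and weights below.
\<close>

datatype letter = A nat nat nat | E nat nat

definition word_letter :: "nat \<Rightarrow> nat set set \<Rightarrow> nat \<Rightarrow> letter" where
  "word_letter n \<pi> i =
     (if smallest \<pi> (order_elem \<pi> i) = order_elem \<pi> i then E (i - 1) (level n \<pi> i)
      else if order_elem \<pi> i \<in> block \<pi> 1 then A (i - 1) 0 (level n \<pi> i)
      else A (i - 1)
             (THE j. j \<in> {1..card ({2..n+1} - order_elem \<pi> ` {i..n})}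
                     \<and> largest n \<pi> i j = order_elem \<pi> (i - 1))
             (level n \<pi> i))"

definition partition_word :: "nat \<Rightarrow> nat set set \<Rightarrow> letter list" where
  "partition_word n \<pi> = map (word_letter n \<pi>) (rev [1..<n+1])"

definition tri :: "nat \<Rightarrow> nat" where
  "tri n = (n + 1) choose 2"

definition triangular :: "nat \<Rightarrow> bool" where
  "triangular t \<longleftrightarrow> t \<in> range tri"

definition tri_inv :: "nat \<Rightarrow> nat" where
  "tri_inv t = (THE n. tri n = t)"

definition tri_ceil :: "nat \<Rightarrow> nat" where
  "tri_ceil m = (LEAST t. triangular t \<and> m \<le> t)"

definition tri_gap :: "nat \<Rightarrow> nat" where
  "tri_gap m = tri_ceil m - m"

datatype weight = Zero | One | Letter letter

type_synonym vertex = "nat \<times> nat"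

type_synonym edge = "vertex \<times> vertex"

text \<open>Meaningful for \<open>i \<ge> 1\<close>.\<close>

definition beta :: "nat \<Rightarrow> nat \<Rightarrow> weight" where
  "beta i l =
     (if triangular (i + l - 1) \<and> i + l - 1 \<ge> tri l
        then Letter (E (tri_inv (i + l - 1) - l) l)
      else if \<not> triangular (i + l - 1) \<and> i + l - 1 \<ge> tri l then One
      else Zero)"

text \<open>
  Meaningful for \<open>i \<ge> 1\<close> and \<open>l \<ge> 1\<close>.  The comparison of an index difference with
  \<open>tri_gap\<close> is made in the integers, because the difference may be negative.
\<close>

definition alpha :: "nat \<Rightarrow> nat \<Rightarrow> weight" where
  "alpha i l =
     (if int (tri_inv (tri_ceil (i + l - 1))) - int l \<ge> int (tri_gap (i + l - 1))
        then Letter (A (tri_inv (tri_ceil (i + l - 1)) - l) (tri_gap (i + l - 1)) (l - 1))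
      else if triangular (i + l - 1) \<and> i + l - 1 < tri l then One
      else Zero)"

definition horizontal_edges :: "edge set" where
  "horizontal_edges = {((i, j), (i - 1, j)) | i j. 1 \<le> i \<and> i \<le> j}"

definition diagonal_edges :: "edge set" where
  "diagonal_edges = {((i, j), (i - 1, j - 1)) | i j. 1 \<le> i \<and> i \<le> j}"

fun edge_weight :: "edge \<Rightarrow> weight" where
  "edge_weight ((i, j), (i', j')) =
     (if j' = j then alpha i (j - i + 1) else beta i (j - i))"

definition network :: "(vertex, edge) pre_digraph" where
  "network =
     \<lparr> verts = {(i, j). i \<le> j},
       arcs = {e \<in> horizontal_edges \<union> diagonal_edges. edge_weight e \<noteq> Zero},
       tail = fst,
       head = snd \<rparr>"

definition source :: "nat \<Rightarrow> vertex" where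
  "source n = (tri n, tri n)"

definition sink :: "nat \<Rightarrow> vertex" where
  "sink k = (0, tri k)"

text \<open>A path is given by its list of edges in order of traversal.\<close>

definition Paths :: "nat \<Rightarrow> nat \<Rightarrow> edge list set" where
  "Paths n k = {p. pre_digraph.apath network (source n) p (sink k)}"

primrec weight_word :: "weight \<Rightarrow> letter list" where
  "weight_word Zero = []"
| "weight_word One = []"
| "weight_word (Letter x) = [x]"

text \<open>No edge of the network has weight \<open>Zero\<close>, so on paths exactly the weights 1 are skipped.\<close>

definition path_word :: "edge list \<Rightarrow> letter list" where
  "path_word p = concat (map (\<lambda>e. weight_word (edge_weight e)) p)"

definition Phi :: "nat \<Rightarrow> nat \<Rightarrow> nat set set \<Rightarrow> edge list" where
  "Phi n k \<pi> = (THE p. p \<in> Paths n k \<and> path_word p = partition_word n \<pi>)"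

end

theory Submission
  imports Defs
begin

text \<open>
  Both partitions and paths are coded by the same sequences \<open>s\<^sub>n, \<dots>, s\<^sub>1\<close> of symbols, where \<open>s\<^sub>i\<close> is
  either a mark \<open>e\<close> or a number \<open>j \<le> i - 1\<close> and the numbers are weakly increasing between
  consecutive marks; the remaining indices of the letters are forced.  On the network, write the
  second coordinate of a vertex as \<open>\<Delta>(N) - g\<close> with \<open>g < N\<close>: a horizontal step emits \<open>g\<close>, a diagonal
  step raises \<open>g\<close>, or emits \<open>e\<close> and lowers \<open>N\<close> when \<open>g\<close> is exhausted.  On partitions, reading the
  order backwards, \<open>p\<^sub>i\<^sub>-\<^sub>1\<close> is the \<open>s\<^sub>i\<close>-th largest of the elements not yet read if \<open>s\<^sub>i > 0\<close>, and their
  maximum otherwise; weak monotonicity of the \<open>s\<^sub>i\<close> says exactly that each block is read in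
  decreasing order.
\<close>

section \<open>Symbol sequences\<close>

text \<open>
  A symbol sequence lists \<open>s\<^sub>n\<close> first; \<open>None\<close> is the mark \<open>e\<close> and \<open>Some j\<close> stands for a letter
  \<open>a\<^bsub>i,j,l\<^esub>\<close>.  The index \<open>i\<close> is the number of symbols still to come.
\<close>

fun admissible :: "nat \<Rightarrow> nat option list \<Rightarrow> bool" where
  "admissible J [] = True"
| "admissible J (None # s) = admissible 0 s"
| "admissible J (Some j # s) = (J \<le> j \<and> j \<le> length s \<and> admissible j s)"

text \<open>Numbers raise \<open>l\<close> and marks do not. On a path \<open>l\<close> is
  \<open>j - i\<close> at the vertex \<open>(i, j)\<close> before the final run; on a partition it
  is the \<open>level\<close>.\<close>

fun letters :: "nat \<Rightarrow> nat option list \<Rightarrow> letter list" where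
  "letters l [] = []"
| "letters l (None # s) = E (length s) l # letters l s"
| "letters l (Some j # s) = A (length s) j l # letters (Suc l) s"

text \<open>This count fixes the sink index \<open>k\<close> of a path and, together with the
  length, the number of blocks of a partition.\<close>

definition falls :: "nat option list \<Rightarrow> nat" where
  "falls s = length (filter (\<lambda>x. x \<noteq> None) s)"

lemma falls_simps [simp]:
  "falls [] = 0" "falls (None # s) = falls s" "falls (Some j # s) = Suc (falls s)"
  by (simp_all add: falls_def)

lemma admissible_mono: "admissible J s \<Longrightarrow> I \<le> J \<Longrightarrow> admissible I s"
  by (induction J s rule: admissible.induct) auto

lemma letters_inject: "letters l s = letters l t \<Longrightarrow> s = t"
proof (induction l s arbitrary: t rule: letters.induct)
  case (1 l)
  then show ?case
    by (cases "(l, t)" rule: letters.cases) auto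
next
  case (2 l s)
  then show ?case
    by (cases "(l, t)" rule: letters.cases) auto
next
  case (3 l j s)
  then show ?case
    by (cases "(l, t)" rule: letters.cases) auto
qed

section \<open>Words of paths\<close>

lemma tri_0 [simp]: "tri 0 = 0"
  by (simp add: tri_def)

lemma tri_Suc [simp]: "tri (Suc N) = tri N + Suc N"
  by (simp add: tri_def numeral_2_eq_2)

lemma strict_mono_tri: "strict_mono tri"
  by (simp add: strict_mono_Suc_iff)

lemma tri_less_iff [simp]: "tri a < tri b \<longleftrightarrow> a < b"
  by (rule strict_mono_less [OF strict_mono_tri])

lemma tri_le_iff [simp]: "tri a \<le> tri b \<longleftrightarrow> a \<le> b"
  by (rule strict_mono_less_eq [OF strict_mono_tri])

lemma tri_eq_iff [simp]: "tri a = tri b \<longleftrightarrow> a = b"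
  by (rule strict_mono_eq [OF strict_mono_tri])

lemma le_tri: "N \<le> tri N"
  by (induction N) auto

lemma tri_inv_tri [simp]: "tri_inv (tri N) = N"
  by (simp add: tri_inv_def)

lemma triangular_tri [simp]: "triangular (tri N)"
  by (simp add: triangular_def)

text \<open>
  \<open>state N l g i\<close> describes the vertex \<open>(i, i + l)\<close> on row \<open>\<Delta>(N) - g\<close>.  The case \<open>g = 0\<close>, \<open>l \<ge> N\<close> is the
  final horizontal run of weight 1.
\<close>

definition state :: "nat \<Rightarrow> nat \<Rightarrow> nat \<Rightarrow> nat \<Rightarrow> bool" where
  "state N l g i \<longleftrightarrow> i + l + g = tri N \<and> (g = 0 \<or> g < N \<and> l < N)"

text \<open>Consecutive triangular numbers \<open>tri (N - 1)\<close> and \<open>tri N\<close>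
  differ by \<open>N\<close>, so a distance below \<open>N\<close> from \<open>tri N\<close>
  downwards reaches no smaller one.\<close>

lemma tri_between: "tri M + g = tri N \<Longrightarrow> g < N \<Longrightarrow> g = 0"
proof (rule ccontr)
  assume a: "tri M + g = tri N" "g < N" "g \<noteq> 0"
  then have "M < N"
    by (metis add_0_right add_le_cancel_left le0 le_add_same_cancel1 less_add_same_cancel1 not_gr_zero tri_less_iff)
  then have "tri M \<le> tri (N - 1)"
    by simp
  moreover have "tri N = tri (N - 1) + N"
    using a by (cases N) auto
  ultimately show False
    using a by linarith
qed

lemma tri_ceil_eq:
  assumes "m + g = tri N" "g = 0 \<or> g < N"
  shows "tri_ceil m = tri N"
  unfolding tri_ceil_def
proof (rule Least_equality)
  show "triangular (tri N) \<and> m \<le> tri N"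
    using assms by auto
next
  fix t assume "triangular t \<and> m \<le> t"
  then obtain M where M: "t = tri M" "m \<le> tri M"
    by (auto simp: triangular_def)
  show "tri N \<le> t"
  proof (rule ccontr)
    assume "\<not> tri N \<le> t"
    then have "M < N" "g \<noteq> 0"
      using M assms by (auto intro!: Suc_leI gr0I)
    then have "tri M \<le> tri (N - 1)"
      by simp
    moreover have "tri N = tri (N - 1) + N"
      using \<open>M < N\<close> by (cases N) auto
    ultimately show False
      using assms M \<open>g \<noteq> 0\<close> by linarith
  qed
qed

lemma triangular_iff:
  assumes "m + g = tri N" "g = 0 \<or> g < N"
  shows "triangular m \<longleftrightarrow> g = 0"
proof
  assume "triangular m"
  then obtain M where "m = tri M"
    by (auto simp: triangular_def)
  then show "g = 0"
    using assms tri_between by auto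
qed (use assms in auto)

text \<open>Since \<open>i + l\<close> is \<open>tri N - g\<close>, its triangular ceiling is
  \<open>tri N\<close> and its gap is \<open>g\<close>. For \<open>g = 0\<close>, the test
  \<open>tri N < tri (Suc l)\<close> behind weight 1 becomes \<open>N \<le> l\<close>.\<close>

lemma alpha_state:
  assumes "state N l g i"
  shows "alpha i (Suc l) =
    (if l + g < N then Letter (A (N - Suc l) g l) else if N \<le> l then One else Zero)"
proof -
  have ig: "i + l + g = tri N" and g: "g = 0 \<or> g < N" "g = 0 \<or> l < N"
    using assms by (auto simp: state_def)
  have c: "tri_ceil (i + l) = tri N" "triangular (i + l) \<longleftrightarrow> g = 0"
    using tri_ceil_eq [OF ig] triangular_iff [OF ig] g by auto
  have gap: "tri_gap (i + l) = g"
    using c ig by (simp add: tri_gap_def)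
  have "i + l < tri (Suc l) \<longleftrightarrow> N \<le> l" if "g = 0"
    using ig that tri_less_iff [of N "Suc l"] by (simp del: tri_Suc tri_less_iff) auto
  moreover have "int N - int (Suc l) \<ge> int g \<longleftrightarrow> l + g < N"
    by auto
  ultimately show ?thesis
    using c gap g by (auto simp add: alpha_def simp del: tri_Suc)
qed

text \<open>The diagonal weight looks at \<open>i + l\<close>, one less than the row
  \<open>tri N - g\<close>. This is \<open>tri (N - 1)\<close> if \<open>Suc g = N\<close>, and lies
  strictly between two triangular numbers otherwise.\<close>

lemma beta_state:
  assumes "state N l g (Suc i)"
  shows "beta (Suc i) l =
    (if N \<le> l then Zero else if Suc g = N then Letter (E (N - Suc l) l) else One)"
proof -
  have ig: "Suc (i + l) + g = tri N" and g: "g = 0 \<or> g < N" "g = 0 \<or> l < N"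
    using assms by (auto simp: state_def)
  have N: "N > 0"
    using ig by (cases N) auto
  then have TN: "tri N = tri (N - 1) + N"
    by (cases N) auto
  show ?thesis
  proof (cases "Suc g = N")
    case True
    then have "i + l = tri (N - 1)"
      using ig TN by auto
    moreover have "N - 1 - l = N - Suc l" "l \<le> N - 1 \<longleftrightarrow> \<not> N \<le> l"
      using N by auto
    ultimately show ?thesis
      using True by (auto simp: beta_def)
  next
    case False
    then have lt: "Suc g < N"
      using g N by auto
    have "i + l + Suc g = tri N"
      using ig by simp
    then have "\<not> triangular (i + l)"
      using triangular_iff lt by blast
    moreover have "tri l \<le> i + l \<longleftrightarrow> l < N"
    proof
      assume "tri l \<le> i + l"
      then have "tri l < tri N" using ig by linarith
      then show "l < N" by simp
    next
      assume "l < N"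
      then have "tri l \<le> tri (N - 1)" by simp
      then show "tri l \<le> i + l" using ig TN lt by linarith
    qed
    ultimately show ?thesis
      using False by (auto simp: beta_def)
  qed
qed

section \<open>Paths of the network as walks in the coordinates \<open>i\<close> and
  \<open>j - i\<close>\<close>

lemma network_simps [simp]:
  "verts network = {(i, j). i \<le> j}" "tail network = fst" "head network = snd"
  by (simp_all add: network_def)

text \<open>With \<open>l\<close> for \<open>j - i\<close>, every vertex is
  \<open>(i, i + l)\<close>, truncated subtraction disappears from the weights, and the induction
  follows the first edge.\<close>

inductive walk :: "nat \<Rightarrow> nat \<Rightarrow> edge list \<Rightarrow> nat \<Rightarrow> bool" for k where
  Nil: "l = tri k \<Longrightarrow> walk k l [] 0"
| Horizontal: "alpha (Suc i) (Suc l) \<noteq> Zero \<Longrightarrow> walk k (Suc l) p i \<Longrightarrow>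
    walk k l (((Suc i, Suc i + l), (i, Suc i + l)) # p) (Suc i)"
| Diagonal: "beta (Suc i) l \<noteq> Zero \<Longrightarrow> walk k l p i \<Longrightarrow>
    walk k l (((Suc i, Suc i + l), (i, i + l)) # p) (Suc i)"

lemma edge_from_iff:
  "e \<in> arcs network \<and> fst e = (i, j) \<and> i \<le> j \<longleftrightarrow>
    (\<exists>i' l. i = Suc i' \<and> j = Suc i' + l \<and>
      (alpha (Suc i') (Suc l) \<noteq> Zero \<and> e = ((Suc i', Suc i' + l), (i', Suc i' + l)) \<or>
       beta (Suc i') l \<noteq> Zero \<and> e = ((Suc i', Suc i' + l), (i', i' + l))))"
proof
  assume "e \<in> arcs network \<and> fst e = (i, j) \<and> i \<le> j"
  then obtain j' where e: "e = ((i, j), (i - 1, j'))" "j' = j \<or> j' = j - 1"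
    "edge_weight e \<noteq> Zero" "1 \<le> i" "i \<le> j"
    by (auto simp: network_def horizontal_edges_def diagonal_edges_def)
  obtain i' l where "i = Suc i'" "j = Suc i' + l"
    using e by (metis One_nat_def Suc_le_D le_Suc_ex)
  then show "\<exists>i' l. i = Suc i' \<and> j = Suc i' + l \<and>
      (alpha (Suc i') (Suc l) \<noteq> Zero \<and> e = ((Suc i', Suc i' + l), (i', Suc i' + l)) \<or>
       beta (Suc i') l \<noteq> Zero \<and> e = ((Suc i', Suc i' + l), (i', i' + l)))"
    using e by (intro exI [of _ i'] exI [of _ l]) (auto split: if_splits)
next
  assume "\<exists>i' l. i = Suc i' \<and> j = Suc i' + l \<and>
      (alpha (Suc i') (Suc l) \<noteq> Zero \<and> e = ((Suc i', Suc i' + l), (i', Suc i' + l)) \<or>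
       beta (Suc i') l \<noteq> Zero \<and> e = ((Suc i', Suc i' + l), (i', i' + l)))"
  then show "e \<in> arcs network \<and> fst e = (i, j) \<and> i \<le> j"
    by (fastforce simp: network_def horizontal_edges_def diagonal_edges_def)
qed

lemma walk_iff_awalk:
  "walk k l p i \<longleftrightarrow> pre_digraph.awalk network (i, i + l) p (sink k)"
proof -
  interpret pre_digraph network .
  have 1: "walk k l p i \<Longrightarrow> awalk (i, i + l) p (sink k)"
  proof (induction rule: walk.induct)
    case (Nil l)
    then show ?case
      by (simp add: awalk_def sink_def)
  next
    case (Horizontal i l p)
    let ?e = "((Suc i, Suc i + l), (i, Suc i + l))"
    have "?e \<in> arcs network"
      using Horizontal.hyps edge_from_iff [of ?e "Suc i" "Suc i + l"] by blast
    then show ?case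
      using Horizontal.IH by (auto simp: awalk_def)
  next
    case (Diagonal i l p)
    let ?e = "((Suc i, Suc i + l), (i, i + l))"
    have "?e \<in> arcs network"
      using Diagonal.hyps edge_from_iff [of ?e "Suc i" "Suc i + l"] by blast
    then show ?case
      using Diagonal.IH by (auto simp: awalk_def)
  qed
  have 2: "awalk (i, i + l) p (sink k) \<Longrightarrow> walk k l p i"
  proof (induction p arbitrary: i l)
    case Nil
    then show ?case
      by (auto simp: awalk_def sink_def intro: walk.intros)
  next
    case (Cons e p)
    then have "e \<in> arcs network" "fst e = (i, i + l)"
      by (auto simp: awalk_def)
    then obtain i' where i: "i = Suc i'" and
      e: "alpha (Suc i') (Suc l) \<noteq> Zero \<and> e = ((Suc i', Suc i' + l), (i', Suc i' + l)) \<or>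
       beta (Suc i') l \<noteq> Zero \<and> e = ((Suc i', Suc i' + l), (i', i' + l))"
      using edge_from_iff [of e i "i + l"] by auto
    have t: "cas (snd e) p (sink k)" "set p \<subseteq> arcs network"
      using Cons.prems by (auto simp: awalk_def)
    from e show ?case
    proof (elim disjE conjE)
      assume "alpha (Suc i') (Suc l) \<noteq> Zero" and e: "e = ((Suc i', Suc i' + l), (i', Suc i' + l))"
      moreover have "awalk (i', i' + Suc l) p (sink k)"
        using t e by (auto simp: awalk_def)
      ultimately show ?case
        using Cons.IH walk.Horizontal i by metis
    next
      assume "beta (Suc i') l \<noteq> Zero" and e: "e = ((Suc i', Suc i' + l), (i', i' + l))"
      moreover have "awalk (i', i' + l) p (sink k)"
        using t e by (auto simp: awalk_def)
      ultimately show ?case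
        using Cons.IH walk.Diagonal i by metis
    qed
  qed
  show ?thesis
    using 1 2 by blast
qed

text \<open>The first coordinate drops at every edge, so no vertex repeats and every walk is a
  path.\<close>

lemma walk_distinct:
  assumes "walk k l p i"
  shows "distinct (pre_digraph.awalk_verts network (i, i + l) p)"
proof -
  interpret pre_digraph network .
  have "distinct (awalk_verts (i, i + l) p) \<and> (\<forall>v \<in> set (awalk_verts (i, i + l) p). fst v \<le> i)"
    using assms by induction fastforce+
  then show ?thesis by blast
qed

lemma Paths_iff_walk: "p \<in> Paths n k \<longleftrightarrow> walk k 0 p (tri n)"
proof -
  interpret pre_digraph network .
  show ?thesis
    using walk_iff_awalk [of k 0 p "tri n"] walk_distinct [of k 0 p "tri n"]
    by (auto simp: Paths_def apath_def source_def)
qed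

section \<open>The correspondence between walks and admissible sequences\<close>

lemma path_word_Nil [simp]: "path_word [] = []"
  by (simp add: path_word_def)

lemma path_word_Diagonal [simp]:
  "path_word (((Suc i, Suc (i + l)), (i', i + l)) # p) = weight_word (beta (Suc i) l) @ path_word p"
  by (simp add: path_word_def)

lemma path_word_Horizontal [simp]:
  "path_word (((Suc i, Suc (i + l)), (i', Suc (i + l))) # p) = weight_word (alpha (Suc i) (Suc l)) @ path_word p"
  by (simp add: path_word_def)

text \<open>If \<open>g > 0\<close>, then \<open>l\<close> and \<open>g\<close> are both below
  \<open>N\<close>, so \<open>l + g \<le> 2 * N - 2\<close>, which is less than
  \<open>tri N\<close>. Hence \<open>i = 0\<close> is reached only in the final run.\<close>

lemma state_0:
  assumes "state N l g 0"
  shows "g = 0 \<and> N \<le> l"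
proof -
  have "tri N \<ge> 2 * N - 1" for N
    by (induction N) auto
  from this [of N] show ?thesis
    using assms le_tri [of N] by (auto simp: state_def)
qed

lemma state_horizontal:
  "state N l g (Suc i) \<Longrightarrow> l + g < N \<or> N \<le> l \<Longrightarrow> state N (Suc l) g i"
  by (auto simp: state_def)

lemma state_diagonal:
  "state N l g (Suc i) \<Longrightarrow> Suc g < N \<Longrightarrow> l < N \<Longrightarrow> state N l (Suc g) i"
  by (auto simp: state_def)

lemma state_diagonal_last:
  "state N l g (Suc i) \<Longrightarrow> Suc g = N \<Longrightarrow> state (N - 1) l 0 i"
  by (auto simp: state_def)

text \<open>A number raises \<open>l\<close>, a mark lowers \<open>N\<close>, so
  \<open>N - l\<close> symbols remain. Between marks \<open>g\<close> never falls, which makes the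
  numbers weakly increasing. The \<open>min\<close> covers the final run, where \<open>l\<close>
  grows beyond \<open>N\<close> without letters; at the sink \<open>N = k\<close>.\<close>

lemma walk_sound:
  assumes "walk k l p i" "state N l g i"
  shows "\<exists>s. length s = N - l \<and> admissible g s \<and> path_word p = letters l s \<and>
    k = min l N + falls s"
  using assms
proof (induction arbitrary: N g rule: walk.induct)
  case (Nil l)
  then have "g = 0" "N \<le> l"
    using state_0 by blast+
  then show ?case
    using Nil by (auto simp: state_def)
next
  case (Horizontal i l p)
  show ?case
  proof (cases "l + g < N")
    case True
    then obtain s where s: "length s = N - Suc l" "admissible g s"
      "path_word p = letters (Suc l) s" "k = min (Suc l) N + falls s"
      using Horizontal.IH [of N g] state_horizontal [OF Horizontal.prems] by auto
    then show ?thesis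
      using True alpha_state [OF Horizontal.prems]
      by (intro exI [of _ "Some g # s"]) auto
  next
    case False
    then have l: "N \<le> l"
      using Horizontal.hyps alpha_state [OF Horizontal.prems] by (auto split: if_splits)
    then show ?thesis
      using Horizontal.IH [of N g] state_horizontal [OF Horizontal.prems] False
        alpha_state [OF Horizontal.prems] by auto
  qed
next
  case (Diagonal i l p)
  note b = beta_state [OF Diagonal.prems]
  have l: "l < N"
    using Diagonal.hyps b by (auto split: if_splits)
  show ?case
  proof (cases "Suc g = N")
    case True
    then obtain s where s: "length s = N - 1 - l" "admissible 0 s"
      "path_word p = letters l s" "k = min l (N - 1) + falls s"
      using Diagonal.IH state_diagonal_last [OF Diagonal.prems] by blast
    then show ?thesis
      using True l b by (intro exI [of _ "None # s"]) auto
  next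
    case False
    then have g: "Suc g < N"
      using Diagonal.prems l by (auto simp: state_def)
    then obtain s where "length s = N - l" "admissible (Suc g) s"
      "path_word p = letters l s" "k = min l N + falls s"
      using Diagonal.IH state_diagonal [OF Diagonal.prems _ l] by blast
    \<comment> \<open>This edge has weight 1, so the code of the tail serves unchanged, with its
      lower bound relaxed from \<open>Suc g\<close> to \<open>g\<close>.\<close>
    then show ?thesis
      using False l b admissible_mono [of "Suc g" s g] by (intro exI [of _ s]) auto
  qed
qed

lemma diagonal_word_ne:
  assumes "state N l g (Suc i)" "beta (Suc i) l \<noteq> Zero" "walk k l q i"
  shows "weight_word (beta (Suc i) l) @ path_word q \<noteq> A a g b # w"
proof -
  note b = beta_state [OF assms(1)]
  have l: "l < N"
    using assms(2) b by (auto split: if_splits)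
  show ?thesis
  proof (cases "Suc g = N")
    case False
    then have "Suc g < N"
      using assms(1) l by (auto simp: state_def)
    then obtain s where s: "admissible (Suc g) s" "path_word q = letters l s"
      using walk_sound [OF assms(3) state_diagonal [OF assms(1) _ l]] by blast
    then show ?thesis
      using b l False by (cases "(l, s)" rule: letters.cases) auto
  qed (use b l in auto)
qed

text \<open>After a diagonal step the next number exceeds \<open>g\<close>, so the two branches emit different words.\<close>

lemma horizontal_diagonal_word_ne:
  assumes "state N l g (Suc i)" "beta (Suc i) l \<noteq> Zero" "walk k l q i" "alpha (Suc i) (Suc l) \<noteq> Zero"
  shows "weight_word (alpha (Suc i) (Suc l)) @ w \<noteq> weight_word (beta (Suc i) l) @ path_word q"
  using diagonal_word_ne [OF assms(1-3)] assms(2,4) alpha_state [OF assms(1)] beta_state [OF assms(1)]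
  by (auto split: if_splits) metis

text \<open>Walks that start with different edges have different words; if they start with the same
  edge, its weight cancels and the tails are compared.\<close>

lemma walk_unique:
  assumes "walk k l p i" "walk k l q i" "state N l g i" "path_word p = path_word q"
  shows "p = q"
  using assms
proof (induction arbitrary: N g q rule: walk.induct)
  case (Nil l)
  then show ?case
    by (auto elim: walk.cases)
next
  case (Horizontal i l p)
  note st = Horizontal.prems(2)
  have lg: "l + g < N \<or> N \<le> l"
    using Horizontal.hyps alpha_state [OF st] by (auto split: if_splits)
  from Horizontal.prems(1) show ?case
  proof cases
    case (Horizontal q')
    then show ?thesis
      using Horizontal.prems Horizontal.IH [of q'] state_horizontal [OF st lg] by auto
  next
    case (Diagonal q')
    then show ?thesis
      using Horizontal.prems Horizontal.hyps horizontal_diagonal_word_ne [OF st, of k q' "path_word p"]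
      by auto
  qed
next
  case (Diagonal i l p)
  note st = Diagonal.prems(2)
  have l: "l < N"
    using Diagonal.hyps beta_state [OF st] by (auto split: if_splits)
  from Diagonal.prems(1) show ?case
  proof cases
    case (Diagonal q')
    \<comment> \<open>The induction hypothesis needs only some state at the next vertex, so it need
      not be decided whether the edge emits a mark.\<close>
    have "state (N - 1) l 0 i \<or> state N l (Suc g) i"
      using state_diagonal_last [OF st] state_diagonal [OF st _ l] st l by (auto simp: state_def)
    then show ?thesis
      using Diagonal Diagonal.prems Diagonal.IH [of q'] by auto
  next
    case (Horizontal q')
    then show ?thesis
      using Diagonal.prems Diagonal.hyps horizontal_diagonal_word_ne [OF st, of k p "path_word q'"]
      by auto
  qed
qed

text \<open>The code dictates each edge: go diagonally until \<open>g\<close> equals the next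
  number, then horizontally; for a mark, go diagonally until \<open>g\<close> is exhausted; with no
  symbol left, follow the final run.\<close>

lemma walk_complete:
  assumes "state N l g i" "length s = N - l" "admissible g s"
  shows "\<exists>p. walk (min l N + falls s) l p i \<and> path_word p = letters l s"
  using assms
proof (induction i arbitrary: N l g s)
  case 0
  then have "g = 0" "N \<le> l" "s = []" "l = tri N"
    using state_0 [OF 0(1)] by (auto simp: state_def)
  then show ?case
    by (intro exI [of _ "[]"]) (auto intro: walk.intros)
next
  case (Suc i)
  note st = Suc.prems(1) and IH = Suc.IH
  note a = alpha_state [OF st] and b = beta_state [OF st]
  \<comment> \<open>A diagonal edge of weight 1 is the move whenever the next symbol cannot be
    emitted yet.\<close>
  have diag: ?case if lt: "Suc g < N" "l < N" "admissible (Suc g) s"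
  proof -
    obtain p where "walk (min l N + falls s) l p i" "path_word p = letters l s"
      using IH [OF state_diagonal [OF st lt(1,2)]] lt Suc.prems by auto
    then show ?thesis
      using b lt walk.Diagonal [of i l _ p]
      by (intro exI [of _ "((Suc i, Suc i + l), (i, i + l)) # p"]) auto
  qed
  show ?case
  proof (cases "(g, s)" rule: admissible.cases)
    case (1 J)
    then have l: "N \<le> l"
      using Suc.prems by auto
    then obtain p where "walk (min (Suc l) N + falls []) (Suc l) p i" "path_word p = []"
      using IH [OF state_horizontal [OF st], of "[]"] by auto
    then show ?thesis
      using a l 1 walk.Horizontal [of i l _ p] st
      by (intro exI [of _ "((Suc i, Suc i + l), (i, Suc i + l)) # p"]) (auto simp: state_def)
  next
    case (2 J s')
    then have l: "l < N"
      using Suc.prems by auto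
    show ?thesis
    proof (cases "Suc g = N")
      case True
      have "length s' = N - 1 - l" "admissible 0 s'"
        using 2 Suc.prems by auto
      then obtain p where "walk (min l (N - 1) + falls s') l p i" "path_word p = letters l s'"
        using IH [OF state_diagonal_last [OF st True]] by blast
      then show ?thesis
        using b l True 2 Suc.prems walk.Diagonal [of i l _ p]
        by (intro exI [of _ "((Suc i, Suc i + l), (i, i + l)) # p"]) auto
    next
      case False
      then show ?thesis
        using diag l st 2 Suc.prems by (auto simp: state_def)
    qed
  next
    case (3 J j s')
    then have j: "g \<le> j" "j + l < N"
      using Suc.prems by auto
    show ?thesis
    proof (cases "j = g")
      case True
      have "length s' = N - Suc l" "admissible g s'" "l + g < N \<or> N \<le> l"
        using 3 j True Suc.prems by auto
      then obtain p where "walk (min (Suc l) N + falls s') (Suc l) p i" "path_word p = letters (Suc l) s'"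
        using IH [OF state_horizontal [OF st]] by blast
      then show ?thesis
        using a j True 3 Suc.prems walk.Horizontal [of i l _ p]
        by (intro exI [of _ "((Suc i, Suc i + l), (i, Suc i + l)) # p"]) auto
    next
      case False
      then show ?thesis
        using diag j 3 Suc.prems by auto
    qed
  qed
qed

lemma state_source: "state n 0 0 (tri n)"
  by (simp add: state_def)

section \<open>Words of partitions\<close>

definition rank :: "nat set \<Rightarrow> nat \<Rightarrow> nat" where
  "rank R y = card {z \<in> R. y \<le> z}"

lemma rank_strict_antimono:
  assumes "finite R" "y \<in> R" "y < z"
  shows "rank R z < rank R y"
proof -
  have "{x \<in> R. z \<le> x} \<subseteq> {x \<in> R. y \<le> x}" "y \<in> {x \<in> R. y \<le> x} - {x \<in> R. z \<le> x}"
    using assms(2,3) by auto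
  then have "{x \<in> R. z \<le> x} \<subset> {x \<in> R. y \<le> x}"
    by blast
  then show ?thesis
    unfolding rank_def using assms(1) by (simp add: psubset_card_mono)
qed

lemma inj_on_rank: "finite R \<Longrightarrow> inj_on (rank R) R"
  by (metis inj_onI less_irrefl linorder_neqE_nat rank_strict_antimono)

lemma rank_image:
  assumes "finite R"
  shows "rank R ` R = {1..card R}"
proof (rule card_subset_eq)
  show "rank R ` R \<subseteq> {1..card R}"
  proof
    fix r assume "r \<in> rank R ` R"
    then obtain y where y: "y \<in> R" "r = rank R y" by blast
    have "rank R y \<le> card R"
      unfolding rank_def by (rule card_mono) (use assms in auto)
    moreover have "rank R y > 0"
      unfolding rank_def using assms y by (auto simp: card_gt_0_iff)
    ultimately show "r \<in> {1..card R}"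
      using y by simp
  qed
  show "card (rank R ` R) = card {1..card R}"
    using card_image [OF inj_on_rank [OF assms]] by simp
qed simp

lemma rank_sorted_nth:
  assumes "finite S" "j \<in> {1..card S}"
  shows "rank S (rev (sorted_list_of_set S) ! (j - 1)) = j"
proof -
  define xs where "xs = sorted_list_of_set S"
  define m where "m = card S - j"
  have xs: "sorted_wrt (<) xs" "set xs = S" "length xs = card S" "distinct xs"
    using assms by (simp_all add: xs_def)
  have m: "m < length xs"
    using assms xs by (auto simp: m_def)
  have "{z \<in> S. xs ! m \<le> z} = (!) xs ` {m..<length xs}"
  proof
    show "{z \<in> S. xs ! m \<le> z} \<subseteq> (!) xs ` {m..<length xs}"
    proof
      fix z assume "z \<in> {z \<in> S. xs ! m \<le> z}"
      then obtain q where q: "q < length xs" "z = xs ! q" "xs ! m \<le> xs ! q"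
        using xs by (auto simp: in_set_conv_nth)
      then have "m \<le> q"
        using xs(1) m by (metis leD not_le_imp_less sorted_wrt_nth_less)
      then show "z \<in> (!) xs ` {m..<length xs}"
        using q by auto
    qed
    show "(!) xs ` {m..<length xs} \<subseteq> {z \<in> S. xs ! m \<le> z}"
      using xs by (auto simp: sorted_nth_mono strict_sorted_imp_sorted)
  qed
  moreover have "inj_on ((!) xs) {m..<length xs}"
    using xs by (auto intro: inj_on_nth)
  ultimately have "rank S (xs ! m) = length xs - m"
    by (simp add: rank_def card_image)
  moreover have "rev xs ! (j - 1) = xs ! m"
    using assms xs by (auto simp: rev_nth m_def)
  ultimately show ?thesis
    using assms xs by (auto simp: xs_def [symmetric] m_def)
qed

text \<open>Translates the index \<open>j\<close> of \<open>largest\<close> into a rank.\<close>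

lemma sorted_nth_eq_iff_rank:
  assumes "finite S" "y \<in> S" "j \<in> {1..card S}"
  shows "rev (sorted_list_of_set S) ! (j - 1) = y \<longleftrightarrow> rank S y = j"
proof -
  have "rev (sorted_list_of_set S) ! (j - 1) \<in> S"
    using assms by (metis Suc_pred' atLeastAtMost_iff diff_less_Suc length_rev less_le_trans
        less_one length_sorted_list_of_set nth_mem set_rev set_sorted_list_of_set
        bot_nat_0.not_eq_extremum diff_Suc_1 not_less_eq_eq Suc_le_eq)
  then show ?thesis
    using rank_sorted_nth [OF assms(1,3)] inj_on_rank [OF assms(1)] assms(2)
    by (metis inj_onD)
qed

lemma sorted_list_of_set_insert_greatest:
  assumes "finite B" "\<And>z. z \<in> B \<Longrightarrow> z < (c::nat)"
  shows "sorted_list_of_set (insert c B) = sorted_list_of_set B @ [c]"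
proof -
  have "sorted (sorted_list_of_set B @ [c])" "distinct (sorted_list_of_set B @ [c])"
    "set (sorted_list_of_set B @ [c]) = insert c B"
    using assms by (auto simp: sorted_append less_imp_le)
  then show ?thesis
    by (metis sorted_list_of_set.idem_if_sorted_distinct list.map_ident subset_UNIV)
qed

section \<open>Adding an element to a block, and the effect on the order word\<close>

lemma block_eq:
  assumes "partition_on X \<pi>" "B \<in> \<pi>" "x \<in> B"
  shows "block \<pi> x = B"
  unfolding block_def
  by (rule the_equality) (use assms in \<open>auto simp: partition_on_def disjoint_def\<close>)

lemma block_mem:
  assumes "partition_on X \<pi>" "x \<in> X"
  shows "block \<pi> x \<in> \<pi>" "x \<in> block \<pi> x"
proof -
  obtain B where "B \<in> \<pi>" "x \<in> B"
    using assms by (auto simp: partition_on_def)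
  then show "block \<pi> x \<in> \<pi>" "x \<in> block \<pi> x"
    using block_eq [OF assms(1)] by auto
qed

lemma block_subset: "partition_on X \<pi> \<Longrightarrow> x \<in> X \<Longrightarrow> block \<pi> x \<subseteq> X"
  using block_mem by (metis Union_upper partition_on_def)

text \<open>The choice \<open>B = {}\<close> adds the singleton \<open>{c}\<close>, because a
  partition does not contain the empty set.\<close>

definition graft :: "nat \<Rightarrow> nat set \<Rightarrow> nat set set \<Rightarrow> nat set set" where
  "graft c B \<pi> = insert (insert c B) (\<pi> - {B})"

lemma partition_on_graft:
  assumes "partition_on X \<pi>" "c \<notin> X" "B \<in> \<pi> \<or> B = {}"
  shows "partition_on (insert c X) (graft c B \<pi>)"
proof (rule partition_onI)
  show "\<Union> (graft c B \<pi>) = insert c X"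
    using assms by (auto simp: graft_def partition_on_def)
  show "{} \<notin> graft c B \<pi>"
    using assms by (auto simp: graft_def partition_on_def)
  have d: "C \<inter> D = {}" if "C \<in> \<pi>" "D \<in> \<pi>" "C \<noteq> D" for C D
    using assms(1) that by (auto simp: partition_on_def disjoint_def)
  have "insert c B \<inter> C = {}" if "C \<in> \<pi>" "C \<noteq> B" for C
    using assms that d [of B C] by (auto simp: partition_on_def)
  then show "disjnt p q" if "p \<in> graft c B \<pi>" "q \<in> graft c B \<pi>" "p \<noteq> q" for p q
    using that d unfolding graft_def disjnt_def by blast
qed

lemma block_graft:
  assumes "partition_on X \<pi>" "c \<notin> X" "B \<in> \<pi> \<or> B = {}" "x \<in> insert c X"
  shows "block (graft c B \<pi>) x = (if x \<in> insert c B then insert c B else block \<pi> x)"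
proof (cases "x \<in> insert c B")
  case True
  then show ?thesis
    using block_eq [OF partition_on_graft [OF assms(1-3)], of "insert c B" x]
    by (auto simp: graft_def)
next
  case False
  then have "block \<pi> x \<in> graft c B \<pi>" "x \<in> block \<pi> x"
    using block_mem [OF assms(1)] assms(4) by (auto simp: graft_def)
  then show ?thesis
    using block_eq [OF partition_on_graft [OF assms(1-3)]] False by auto
qed

lemma graft_Diff:
  assumes "partition_on X \<pi>" "c \<notin> X"
  shows "graft c B \<pi> - {insert c B} = \<pi> - {B}"
  using assms by (auto simp: graft_def partition_on_def)

lemma card_graft:
  assumes "partition_on X \<pi>" "c \<notin> X" "finite X" "B \<in> \<pi> \<or> B = {}"
  shows "card (graft c B \<pi>) = (if B = {} then Suc (card \<pi>) else card \<pi>)"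
proof -
  have f: "finite \<pi>" "{} \<notin> \<pi>" and n: "insert c B \<notin> \<pi>"
    using assms finite_elements by (auto simp: partition_on_def)
  then show ?thesis
    using assms(4) by (cases "B = {}") (simp_all add: graft_def card_Suc_Diff1 del: card_Diff_insert)
qed

text \<open>The new element becomes the last entry of the skeleton and, lying in the block of 1, is
  not expanded; all other entries expand as before.\<close>

lemma order_word_graft_greatest:
  assumes \<pi>: "partition_on X \<pi>" and X: "finite X" "1 \<in> X" and c: "\<And>z. z \<in> X \<Longrightarrow> z < c"
  shows "order_word (graft c (block \<pi> 1) \<pi>) = order_word \<pi> @ [c]"
proof -
  define B where "B = block \<pi> 1"
  define \<rho> where "\<rho> = graft c B \<pi>"
  have B: "B \<in> \<pi>" "1 \<in> B" "B \<subseteq> X"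
    using block_mem [OF \<pi> X(2)] block_subset [OF \<pi> X(2)] by (auto simp: B_def)
  have cX: "c \<notin> X"
    using c by blast
  have bl: "block \<rho> x = (if x \<in> insert c B then insert c B else block \<pi> x)" if "x \<in> insert c X" for x
    unfolding \<rho>_def using block_graft [OF \<pi> cX _ that] B by auto
  have b1: "block \<rho> 1 = insert c B"
    using bl [of 1] B X by auto
  have d: "\<rho> - {insert c B} = \<pi> - {B}"
    unfolding \<rho>_def by (rule graft_Diff [OF \<pi> cX])
  define S where "S = B \<union> Max ` (\<pi> - {B})"
  have fin: "finite C" "C \<noteq> {}" "C \<subseteq> X" if "C \<in> \<pi>" for C
    using \<pi> X(1) that by (auto simp: partition_on_def intro: finite_subset)
  have SX: "S \<subseteq> X"
    using B fin Max_in unfolding S_def by blast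
  then have finS: "finite S"
    using X(1) by (rule finite_subset)
  have "order_skeleton \<rho> = sorted_list_of_set (insert c S)"
    unfolding order_skeleton_def b1 d S_def by simp
  also have "\<dots> = sorted_list_of_set S @ [c]"
    by (rule sorted_list_of_set_insert_greatest) (use finS SX c in auto)
  finally have sk: "order_skeleton \<rho> = order_skeleton \<pi> @ [c]"
    unfolding order_skeleton_def S_def B_def .
  have sS: "set (order_skeleton \<pi>) = S"
    unfolding order_skeleton_def B_def [symmetric] S_def [symmetric] using finS by simp
  have "map (\<lambda>x. if x \<in> block \<rho> 1 then [x] else sorted_list_of_set (block \<rho> x - {x}) @ [x]) (order_skeleton \<pi>)
      = map (\<lambda>x. if x \<in> block \<pi> 1 then [x] else sorted_list_of_set (block \<pi> x - {x}) @ [x]) (order_skeleton \<pi>)"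
    unfolding b1 B_def [symmetric] using SX cX by (intro map_cong refl) (auto simp: sS bl)
  then show ?thesis
    unfolding B_def [symmetric] \<rho>_def [symmetric] order_word_def sk b1 by (simp del: map_eq_conv)
qed

text \<open>The maximum \<open>y\<close> of the ground set ends the skeleton, and its expansion is
  its whole block in increasing order. The other blocks do not notice the removal.\<close>

lemma order_word_last_block:
  assumes \<pi>: "partition_on X \<pi>" and X: "finite X" "1 \<in> X"
    and y: "y \<in> X" "\<And>z. z \<in> X \<Longrightarrow> z \<le> y" and n1: "1 \<notin> block \<pi> y"
  shows "order_word \<pi> = order_word (\<pi> - {block \<pi> y}) @ sorted_list_of_set (block \<pi> y)"
proof -
  define C where "C = block \<pi> y"
  define B where "B = block \<pi> 1"
  define \<rho> where "\<rho> = \<pi> - {C}"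
  have C: "C \<in> \<pi>" "y \<in> C" "C \<subseteq> X" and B: "B \<in> \<pi>" "1 \<in> B" "B \<subseteq> X"
    using block_mem [OF \<pi>] block_subset [OF \<pi>] X y by (auto simp: B_def C_def)
  have BC: "B \<noteq> C" "B \<inter> C = {}"
  proof -
    show "B \<noteq> C"
      using B n1 by (auto simp: C_def)
    then show "B \<inter> C = {}"
      using \<pi> B C by (simp add: partition_on_def disjoint_def)
  qed
  have dis: "D \<inter> C = {}" if "D \<in> \<rho>" for D
    using \<pi> C that by (auto simp: \<rho>_def partition_on_def disjoint_def)
  have \<rho>: "partition_on (X - C) \<rho>"
    using \<pi> C dis by (auto simp: \<rho>_def partition_on_def disjoint_def)
  have bl: "block \<rho> x = block \<pi> x" if "x \<in> X - C" for x
    using block_mem [OF \<rho> that] block_eq [OF \<pi>] by (auto simp: \<rho>_def)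
  have b1: "block \<rho> 1 = B"
    using bl [of 1] X BC B by (auto simp: B_def)
  define S where "S = B \<union> Max ` (\<rho> - {B})"
  have fin: "finite D" "D \<noteq> {}" "D \<subseteq> X - C" if "D \<in> \<rho>" for D
    using \<rho> X(1) that by (auto simp: partition_on_def intro: finite_subset)
  have SX: "S \<subseteq> X - C"
    using B BC fin Max_in unfolding S_def by blast
  then have finS: "finite S"
    using X(1) by (metis finite_Diff finite_subset)
  have MC: "Max C = y"
    by (rule Max_eqI) (use C y X finite_subset in auto)
  have yS: "z < y" if "z \<in> S" for z
    using SX that y(2) [of z] C by (metis DiffD1 DiffD2 le_neq_implies_less subsetD)
  have "\<pi> - {B} = insert C (\<rho> - {B})"
    using C BC by (auto simp: \<rho>_def)
  then have "order_skeleton \<pi> = sorted_list_of_set (insert y S)"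
    unfolding order_skeleton_def B_def [symmetric] S_def by (simp add: MC)
  also have "\<dots> = sorted_list_of_set S @ [y]"
    by (rule sorted_list_of_set_insert_greatest) (use finS yS in auto)
  finally have sk: "order_skeleton \<pi> = order_skeleton \<rho> @ [y]"
    unfolding order_skeleton_def S_def b1 .
  have sS: "set (order_skeleton \<rho>) = S"
    unfolding order_skeleton_def b1 S_def [symmetric] using finS by simp
  have "map (\<lambda>x. if x \<in> block \<pi> 1 then [x] else sorted_list_of_set (block \<pi> x - {x}) @ [x]) (order_skeleton \<rho>)
      = map (\<lambda>x. if x \<in> block \<rho> 1 then [x] else sorted_list_of_set (block \<rho> x - {x}) @ [x]) (order_skeleton \<rho>)"
    unfolding b1 B_def [symmetric] using SX by (intro map_cong refl) (auto simp: sS bl)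
  moreover have "sorted_list_of_set (C - {y}) @ [y] = sorted_list_of_set C"
  proof -
    have "z < y" if "z \<in> C - {y}" for z
      using that C y(2) [of z] by force
    then show ?thesis
      using sorted_list_of_set_insert_greatest [of "C - {y}" y] C X
      by (simp add: insert_absorb finite_subset)
  qed
  moreover have "y \<notin> B"
    using BC C by auto
  ultimately show ?thesis
    unfolding C_def [symmetric] \<rho>_def [symmetric] order_word_def sk b1 B_def [symmetric]
    by (simp add: C_def [symmetric] del: map_eq_conv)
qed

section \<open>Decoding a symbol sequence into a partition\<close>

fun bound :: "nat option \<Rightarrow> nat" where
  "bound None = 0"
| "bound (Some j) = j"

text \<open>Because of \<open>max 1\<close>, the symbols \<open>None\<close>, \<open>Some 0\<close>
  and \<open>Some 1\<close> all select the maximum of \<open>R\<close>; they differ only in the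
  block that \<open>host\<close> returns.\<close>

definition pick :: "nat set \<Rightarrow> nat option \<Rightarrow> nat" where
  "pick R x = inv_into R (rank R) (max 1 (bound x))"

lemma pick:
  assumes "finite R" "R \<noteq> {}" "bound x \<le> card R"
  shows "pick R x \<in> R" "rank R (pick R x) = max 1 (bound x)"
proof -
  have "max 1 (bound x) \<in> rank R ` R"
    using assms by (simp add: rank_image Suc_le_eq card_gt_0_iff)
  then show "pick R x \<in> R" "rank R (pick R x) = max 1 (bound x)"
    unfolding pick_def by (rule inv_into_into, rule f_inv_into_f)
qed

lemma pick_greatest:
  assumes "finite R" "bound x = 0" "z \<in> R"
  shows "z \<le> pick R x"
proof (rule ccontr)
  assume "\<not> z \<le> pick R x"
  moreover have "pick R x \<in> R" "rank R (pick R x) = 1"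
    using pick [of R x] assms by auto
  ultimately have "rank R z < 1"
    using rank_strict_antimono [OF assms(1), of "pick R x" z] by simp
  moreover have "rank R z \<in> {1..card R}"
    using rank_image [OF assms(1)] assms(3) by blast
  ultimately show False by simp
qed

lemma pick_rank:
  assumes "finite R" "y \<in> R"
  shows "pick R (Some (rank R y)) = y"
proof -
  have "rank R y \<in> {1..card R}"
    using rank_image [OF assms(1)] assms(2) by blast
  then show ?thesis
    using inj_on_rank [OF assms(1)] assms(2) by (simp add: pick_def)
qed

text \<open>
  \<open>host \<pi> y x\<close> is the block which the current element joins, the empty set meaning that it forms a
  singleton.  \<open>decode c R s\<close> is the partition of \<open>insert c R\<close> coded by \<open>s\<close> when \<open>c = p\<^sub>i\<close> has just been
  read and \<open>R = {1, p\<^sub>1, \<dots>, p\<^sub>i\<^sub>-\<^sub>1}\<close>.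
\<close>

fun host :: "nat set set \<Rightarrow> nat \<Rightarrow> nat option \<Rightarrow> nat set" where
  "host \<pi> y None = {}"
| "host \<pi> y (Some j) = (if j = 0 then block \<pi> 1 else block \<pi> y)"

fun decode :: "nat \<Rightarrow> nat set \<Rightarrow> nat option list \<Rightarrow> nat set set" where
  "decode c R [] = {{c}}"
| "decode c R (x # s) =
    (let y = pick R x; \<pi> = decode y (R - {y}) s in graft c (host \<pi> y x) \<pi>)"

text \<open>The reading order depends on \<open>c\<close>, \<open>R\<close> and the code alone;
  \<open>rev_route\<close> relates it to the order word.\<close>

fun route :: "nat \<Rightarrow> nat set \<Rightarrow> nat option list \<Rightarrow> nat list" where
  "route c R [] = [c]"
| "route c R (x # s) = c # route (pick R x) (R - {pick R x}) s"

text \<open>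
  Here \<open>J\<close> is the lower bound on the next number.  If \<open>J > 0\<close>, then \<open>c\<close> was reached as the \<open>J\<close>-th
  largest unread element from a larger element of its block, which avoids 1.  Truncated subtraction
  makes \<open>c\<close> exceed all of \<open>R\<close> for \<open>J = 0\<close> as well as for \<open>J = 1\<close>.
\<close>

definition slot :: "nat \<Rightarrow> nat set \<Rightarrow> nat \<Rightarrow> bool" where
  "slot J R c \<longleftrightarrow> finite R \<and> c \<notin> R \<and> 0 < c \<and> 0 \<notin> R \<and> 
     (if R = {} then c = 1 \<and> J = 0 else 1 \<in> R) \<and> card {z \<in> R. c < z} = J - 1"

text \<open>The invariant for the unread part of a partition: blocks are read in decreasing order,
  so \<open>c\<close> is the maximum of what is left of its block, and a positive number leads only
  to blocks without 1.\<close>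

definition fits :: "nat \<Rightarrow> nat set \<Rightarrow> nat \<Rightarrow> nat set set \<Rightarrow> bool" where
  "fits J R c \<pi> \<longleftrightarrow> partition_on (insert c R) \<pi> \<and> (\<forall>z \<in> block \<pi> c. z \<le> c) \<and>
     (J \<noteq> 0 \<longrightarrow> 1 \<notin> block \<pi> c)"

lemma slot_greatest:
  assumes "slot 0 R c" "z \<in> R"
  shows "z < c"
proof -
  have "{z \<in> R. c < z} = {}"
    using assms by (auto simp: slot_def)
  then show ?thesis
    using assms by (auto simp: slot_def) (metis linorder_neqE_nat)
qed

text \<open>An element of rank \<open>max 1 (bound x)\<close> leaves \<open>bound x - 1\<close>
  larger ones unread. The element 1 has rank \<open>card R\<close>, which exceeds
  \<open>bound x\<close>, so it is picked only when \<open>R = {1}\<close>.\<close>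

lemma slot_step:
  assumes "slot J R c" "R \<noteq> {}" "bound x < card R"
  shows "slot (bound x) (R - {pick R x}) (pick R x)"
proof -
  define y where "y = pick R x"
  have R: "finite R" "1 \<in> R" "0 \<notin> R"
    using assms by (auto simp: slot_def)
  have y: "y \<in> R" "rank R y = max 1 (bound x)"
    using pick [of R x] R assms by (auto simp: y_def)
  have "{z \<in> R - {y}. y < z} = {z \<in> R. y \<le> z} - {y}"
    by auto
  then have c: "card {z \<in> R - {y}. y < z} = bound x - 1"
    using y R by (simp add: rank_def)
  have "R = {z \<in> R. 1 \<le> z}"
    using R by (auto simp: Suc_le_eq) (metis gr0I)
  then have r1: "rank R 1 = card R"
    by (simp add: rank_def)
  have "y = 1 \<Longrightarrow> bound x = 0 \<and> card R = 1"
    using r1 y assms by (auto simp: max_def split: if_splits)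
  then have "y = 1 \<Longrightarrow> bound x = 0 \<and> R = {1}"
    using R by (metis card_1_singletonE singletonD)
  then show ?thesis
    using c y R unfolding slot_def y_def [symmetric] by (auto intro!: gr0I)
qed

text \<open>Only \<open>J - 1\<close> elements of \<open>R\<close> exceed \<open>c\<close>, so an
  element above \<open>c\<close> has rank at most \<open>J - 1\<close>, which is less than
  \<open>max 1 j\<close>. Here weak monotonicity turns into descent within a block.\<close>

lemma pick_less:
  assumes "slot J R c" "R \<noteq> {}" "J \<le> j" "j < card R"
  shows "pick R (Some j) < c"
proof (rule ccontr)
  define y where "y = pick R (Some j)"
  have R: "finite R" "c \<notin> R" "card {z \<in> R. c < z} = J - 1"
    using assms by (auto simp: slot_def)
  have y: "y \<in> R" "rank R y = max 1 j"
    using pick [of R "Some j"] R assms by (auto simp: y_def)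
  assume "\<not> pick R (Some j) < c"
  then have "c < y"
    using y R y_def by (metis linorder_neqE_nat)
  then have "rank R y \<le> J - 1"
    unfolding rank_def R(3) [symmetric] by (intro card_mono) (use R in auto)
  then show False
    using y assms by auto
qed

text \<open>The host lies below \<open>c\<close>: for the number 0 because then \<open>J = 0\<close>
  and \<open>c\<close> exceeds all of \<open>R\<close>, for a positive number because the host has
  maximum \<open>pick R x\<close>, which is less than \<open>c\<close>. If \<open>J\<close> is
  nonzero, a number is positive too, so its host avoids 1.\<close>

lemma graft_step:
  assumes "slot J R c" "R \<noteq> {}" "bound x < card R" "case x of None \<Rightarrow> True | Some j \<Rightarrow> J \<le> j"
    and "fits (bound x) (R - {pick R x}) (pick R x) \<pi>"
  shows "partition_on R \<pi>" "host \<pi> (pick R x) x \<in> \<pi> \<or> host \<pi> (pick R x) x = {}"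
    "fits J R c (graft c (host \<pi> (pick R x) x) \<pi>)"
    "\<And>z. z \<in> host \<pi> (pick R x) x \<Longrightarrow> z < c"
proof -
  define y where "y = pick R x"
  define B where "B = host \<pi> y x"
  have R: "finite R" "1 \<in> R" "0 \<notin> R" "c \<notin> R"
    using assms by (auto simp: slot_def)
  have y: "y \<in> R"
    using pick [of R x] R assms by (auto simp: y_def)
  then have iy: "insert y (R - {y}) = R"
    by auto
  show p: "partition_on R \<pi>"
    using assms(5) unfolding fits_def y_def [symmetric] iy by simp
  have b: "block \<pi> y \<in> \<pi>" "block \<pi> 1 \<in> \<pi>" "block \<pi> 1 \<subseteq> R"
    using block_mem [OF p] block_subset [OF p] R y by auto
  show B: "host \<pi> (pick R x) x \<in> \<pi> \<or> host \<pi> (pick R x) x = {}"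
    using b by (cases x) (auto simp: y_def)
  have less: "z < c" if "z \<in> B" for z
  proof (cases x)
    case (Some j)
    show ?thesis
    proof (cases "j = 0")
      case True
      then show ?thesis
        using that Some assms b slot_greatest by (auto simp: B_def)
    next
      case False
      then have "z \<le> y"
        using that Some assms(5) by (auto simp: B_def fits_def y_def)
      then show ?thesis
        using pick_less [OF assms(1,2), of j] Some assms(3,4) by (simp add: y_def)
    qed
  qed (use that in \<open>simp add: B_def\<close>)
  then show "\<And>z. z \<in> host \<pi> (pick R x) x \<Longrightarrow> z < c"
    by (simp add: B_def y_def)
  have "block (graft c B \<pi>) c = insert c B"
    using block_graft [OF p R(4), of B c] B by (simp add: B_def y_def)
  moreover have "1 \<notin> insert c B" if "J \<noteq> 0"
    using that assms R unfolding B_def fits_def y_def [symmetric] by (cases x) auto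
  ultimately show "fits J R c (graft c (host \<pi> (pick R x) x) \<pi>)"
    using partition_on_graft [OF p R(4)] B less
    by (auto simp: fits_def B_def [symmetric] y_def [symmetric] intro: less_imp_le)
qed

lemma admissible_Cons:
  "admissible J (x # s) \<longleftrightarrow> bound x \<le> length s \<and> (case x of None \<Rightarrow> True | Some j \<Rightarrow> J \<le> j) \<and>
    admissible (bound x) s"
  by (cases x) auto

lemma decode_fits:
  "slot J R c \<Longrightarrow> card R = length s \<Longrightarrow> admissible J s \<Longrightarrow> fits J R c (decode c R s)"
proof (induction s arbitrary: J R c)
  case Nil
  then have "R = {}" "c = 1" "J = 0"
    by (auto simp: slot_def)
  moreover have "partition_on {1} {{1::nat}}"
    by (simp add: partition_on_def disjoint_def)
  ultimately show ?case
    using block_eq [of "{1}" "{{1}}" "{1}" 1] by (simp add: fits_def)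
next
  case (Cons x s)
  then have R: "R \<noteq> {}" "bound x < card R" "case x of None \<Rightarrow> True | Some j \<Rightarrow> J \<le> j"
    "admissible (bound x) s" "finite R"
    by (auto simp: admissible_Cons slot_def)
  have "pick R x \<in> R"
    using pick R by auto
  then have "card (R - {pick R x}) = length s"
    using Cons.prems R by simp
  then show ?case
    using graft_step(3) [OF Cons.prems(1) R(1-3)] Cons.IH [OF slot_step [OF Cons.prems(1) R(1,2)]] R
    by (simp add: Let_def)
qed

lemma decode_step:
  assumes "slot J R c" "card R = length (x # s)" "admissible J (x # s)"
  shows "R \<noteq> {}" "bound x < card R" "case x of None \<Rightarrow> True | Some j \<Rightarrow> J \<le> j" 
    "slot (bound x) (R - {pick R x}) (pick R x)"
    "card (R - {pick R x}) = length s" "admissible (bound x) s" "pick R x \<in> R"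
    "fits (bound x) (R - {pick R x}) (pick R x) (decode (pick R x) (R - {pick R x}) s)"
proof -
  show R: "R \<noteq> {}" "bound x < card R" "case x of None \<Rightarrow> True | Some j \<Rightarrow> J \<le> j"
    "admissible (bound x) s"
    using assms by (auto simp: admissible_Cons slot_def)
  show "pick R x \<in> R"
    using pick R assms by (auto simp: slot_def)
  then show c: "card (R - {pick R x}) = length s"
    using assms R by (simp add: slot_def)
  show "slot (bound x) (R - {pick R x}) (pick R x)"
    by (rule slot_step [OF assms(1) R(1,2)])
  then show "fits (bound x) (R - {pick R x}) (pick R x) (decode (pick R x) (R - {pick R x}) s)"
    using decode_fits c R by blast
qed

text \<open>A mark creates a block, a number enlarges an existing one, and the final element 1
  accounts for the \<open>Suc\<close>.\<close>

lemma card_decode: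
  "slot J R c \<Longrightarrow> card R = length s \<Longrightarrow> admissible J s \<Longrightarrow>
    card (decode c R s) + falls s = Suc (length s)"
proof (induction s arbitrary: J R c)
  case (Cons x s)
  note st = decode_step [OF Cons.prems]
  note g = graft_step [OF Cons.prems(1) st(1-3,8)]
  define \<pi> where "\<pi> = decode (pick R x) (R - {pick R x}) s"
  have R: "c \<notin> R" "finite R" "1 \<in> R"
    using Cons.prems(1) st(1) by (auto simp: slot_def)
  have "host \<pi> (pick R x) x = {} \<longleftrightarrow> x = None"
    using block_mem [OF g(1)] st(7) R unfolding \<pi>_def by (cases x) auto
  then have "card (decode c R (x # s)) = (if x = None then Suc (card \<pi>) else card \<pi>)"
    using card_graft [OF g(1) R(1,2) g(2)] by (simp add: Let_def \<pi>_def)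
  then show ?case
    using Cons.IH [OF st(4-6)] by (cases x) (auto simp: \<pi>_def)
qed simp

text \<open>Removing \<open>c\<close> from its block \<open>C\<close> undoes one graft. The
  remainder \<open>B\<close> determines the symbol, and the smaller partition again satisfies the
  invariant.\<close>

lemma decode_surj:
  "slot J R c \<Longrightarrow> fits J R c \<pi> \<Longrightarrow>
    \<exists>s. length s = card R \<and> admissible J s \<and> decode c R s = \<pi>"
proof (induction "card R" arbitrary: J R c \<pi>)
  case 0
  then have "R = {}" "c = 1" "J = 0"
    by (auto simp: slot_def split: if_splits)
  then have "partition_on {1} \<pi>"
    using 0 by (simp add: fits_def)
  then have "\<Union> \<pi> = {1}" "{} \<notin> \<pi>"
    by (simp_all add: partition_on_def)
  then have "D = {1}" if "D \<in> \<pi>" for D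
    using that by (metis Union_upper subset_singletonD)
  moreover have "\<pi> \<noteq> {}"
    using \<open>\<Union> \<pi> = {1}\<close> by auto
  ultimately have "\<pi> = {{1}}"
    by blast
  with \<open>R = {}\<close> \<open>c = 1\<close> show ?case
    by (intro exI [of _ "[]"]) auto
next
  case (Suc m)
  have R: "c \<notin> R" "finite R" "R \<noteq> {}" "1 \<in> R" "0 \<notin> R" "0 < c" "card {z \<in> R. c < z} = J - 1"
    using Suc.prems Suc.hyps(2) by (auto simp: slot_def split: if_splits)
  have p: "partition_on (insert c R) \<pi>"
    using Suc.prems by (simp add: fits_def)
  define C where "C = block \<pi> c"
  define B where "B = C - {c}"
  have C: "C \<in> \<pi>" "c \<in> C" "C \<subseteq> insert c R" "\<And>z. z \<in> C \<Longrightarrow> z \<le> c" "J \<noteq> 0 \<Longrightarrow> 1 \<notin> C"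
    using block_mem [OF p] block_subset [OF p] Suc.prems by (auto simp: C_def fits_def)
  have B: "B \<subseteq> R" "insert c B = C" "finite B" "\<And>z. z \<in> B \<Longrightarrow> z < c"
  proof -
    show "B \<subseteq> R" "insert c B = C" using C by (auto simp: B_def)
    then show "finite B" using R finite_subset by blast
    show "z < c" if "z \<in> B" for z
      using C(4) [of z] that by (simp add: B_def)
  qed
  define \<pi>' where "\<pi>' = (if B = {} then \<pi> - {C} else insert B (\<pi> - {C}))"
  have dis: "D \<inter> C = {}" if "D \<in> \<pi>" "D \<noteq> C" for D
    using p C that by (auto simp: partition_on_def disjoint_def)
  have Un: "\<Union> \<pi> = insert c R" "{} \<notin> \<pi>"
    using p by (auto simp: partition_on_def)
  have p': "partition_on R \<pi>'"
  proof (rule partition_onI)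
    have "\<Union> (\<pi> - {C}) = \<Union> \<pi> - C"
      using C dis by blast
    moreover have "\<Union> \<pi>' = \<Union> (\<pi> - {C}) \<union> B"
      by (auto simp: \<pi>'_def)
    ultimately show "\<Union> \<pi>' = R"
      using Un B C R by auto
    show "{} \<notin> \<pi>'"
      using Un by (auto simp: \<pi>'_def split: if_splits)
    have "D \<inter> B = {}" if "D \<in> \<pi> - {C}" for D
      using dis that B by auto
    moreover have "D \<inter> D' = {}" if "D \<in> \<pi>" "D' \<in> \<pi>" "D \<noteq> D'" for D D'
      using p that by (simp add: partition_on_def disjoint_def)
    ultimately show "disjnt D D'" if "D \<in> \<pi>'" "D' \<in> \<pi>'" "D \<noteq> D'" for D D'
      using that unfolding \<pi>'_def disjnt_def
      by (metis DiffE Int_commute insertE)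
  qed
  have "B \<notin> \<pi> - {C}" if "B \<noteq> {}"
    using dis [of B] B(2) that by auto
  moreover have "{} \<notin> \<pi>" using Un by simp
  ultimately have gr: "graft c B \<pi>' = \<pi>"
    using C B by (auto simp: graft_def \<pi>'_def)
  have blB: "block \<pi>' z = B" if "z \<in> B" for z
    using that by (intro block_eq [OF p']) (auto simp: \<pi>'_def)
  \<comment> \<open>In the last case the next element read must be the predecessor of
    \<open>c\<close> in its block, which is \<open>Max B\<close>.\<close>
  define x where "x = (if B = {} then None else if 1 \<in> C then Some 0 else Some (rank R (Max B)))"
  define y where "y = pick R x"
  have big: "Max B \<in> B" "Max B \<in> R" "y = Max B" "0 < bound x" "bound x < card R" "J \<le> bound x"
    if "B \<noteq> {}" "1 \<notin> C"
  proof -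
    have x: "x = Some (rank R (Max B))"
      using that by (simp add: x_def)
    show M: "Max B \<in> B"
      using B that by auto
    then show MR: "Max B \<in> R" using B by auto
    show "y = Max B"
      using pick_rank [OF R(2) MR] x by (simp add: y_def)
    show "0 < bound x"
      using rank_image [OF R(2)] MR x by force
    \<comment> \<open>Thus \<open>Max B\<close> ranks strictly before 1, whose rank is at most
      \<open>card R\<close>.\<close>
    have "1 < Max B"
      using M MR that R B by (metis insertI2 less_one linorder_neqE_nat)
    then show "bound x < card R"
      using rank_strict_antimono [OF R(2,4)] rank_image [OF R(2)] R(4) x
      by (metis atLeastAtMost_iff bound.simps(2) imageI order_less_le_trans)
    \<comment> \<open>The \<open>J - 1\<close> elements above \<open>c\<close>, together with
      \<open>Max B\<close> below \<open>c\<close>, all count towards the rank of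
      \<open>Max B\<close>.\<close>
    have "insert (Max B) {z \<in> R. c < z} \<subseteq> {z \<in> R. Max B \<le> z}"
      using MR B(4) [OF M] by auto
    then have "card (insert (Max B) {z \<in> R. c < z}) \<le> rank R (Max B)"
      unfolding rank_def by (intro card_mono) (use R in auto)
    moreover have "Max B \<notin> {z \<in> R. c < z}"
      using B(4) [OF M] by auto
    ultimately show "J \<le> bound x"
      using R x by simp
  qed
  have bx: "bound x < card R"
    using big Suc.hyps(2) by (auto simp: x_def)
  have cx: "case x of None \<Rightarrow> True | Some j \<Rightarrow> J \<le> j"
    using big C(5) by (auto simp: x_def)
  have yR: "y \<in> R"
    unfolding y_def using pick R bx by simp
  have bl: "block \<pi>' y \<subseteq> R"
    using block_subset [OF p' yR] .
  have "fits (bound x) (R - {y}) y \<pi>'"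
  proof (cases "B = {} \<or> 1 \<in> C")
    case True
    then have "bound x = 0"
      by (auto simp: x_def)
    then show ?thesis
      using p' yR pick_greatest [OF R(2), of x] bl by (auto simp: fits_def insert_absorb y_def)
  next
    case False
    then have "block \<pi>' y = B" "y = Max B" "1 \<notin> B"
      using big blB B by auto
    then show ?thesis
      using p' yR B by (auto simp: fits_def insert_absorb)
  qed
  moreover have "m = card (R - {y})"
    using Suc.hyps(2) yR R by simp
  ultimately obtain s where s: "length s = card (R - {y})" "admissible (bound x) s"
    "decode y (R - {y}) s = \<pi>'"
    using Suc.hyps(1) slot_step [OF Suc.prems(1) R(3) bx] unfolding y_def by blast
  have "host \<pi>' y x = B"
  proof (cases "B = {} \<or> 1 \<in> C")
    case True
    moreover have "1 \<in> B" if "1 \<in> C"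
      using that B(2) R(1,4) by blast
    ultimately show ?thesis
      using blB [of 1] by (auto simp add: x_def simp del: One_nat_def)
  next
    case False
    then show ?thesis
      using big blB [of y] by (simp add: x_def)
  qed
  then have "decode c R (x # s) = \<pi>"
    using s gr by (simp add: Let_def y_def)
  moreover have "admissible J (x # s)" "length (x # s) = card R"
    using s bx cx yR R by (auto simp: admissible_Cons)
  ultimately show ?case by blast
qed

section \<open>Reading the symbols back from a partition, along a list whose tails are the unread
  elements\<close>

fun encode :: "nat set set \<Rightarrow> nat list \<Rightarrow> nat option list" where
  "encode \<pi> (c # y # r) =
    (if Min (block \<pi> c) = c then None
     else if c \<in> block \<pi> 1 then Some 0
     else Some (rank (set (y # r)) y)) # encode \<pi> (y # r)"
| "encode \<pi> _ = []"

lemma length_encode [simp]: "length (encode \<pi> r) = length r - 1"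
  by (induction \<pi> r rule: encode.induct) auto

text \<open>The partition enters only through two predicates, being a block minimum and lying in the
  block of 1. Grafting a larger element changes neither on the old elements.\<close>

lemma encode_cong:
  assumes "\<And>z. z \<in> set r \<Longrightarrow> Min (block \<pi> z) = z \<longleftrightarrow> Min (block \<rho> z) = z"
    "\<And>z. z \<in> set r \<Longrightarrow> z \<in> block \<pi> 1 \<longleftrightarrow> z \<in> block \<rho> 1"
  shows "encode \<pi> r = encode \<rho> r"
  using assms by (induction \<pi> r rule: encode.induct) simp_all

lemma route_props:
  "slot J R c \<Longrightarrow> card R = length s \<Longrightarrow> admissible J s \<Longrightarrow>
    set (route c R s) = insert c R \<and> distinct (route c R s) \<and> length (route c R s) = Suc (card R)
    \<and> hd (route c R s) = c \<and> last (route c R s) = 1"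
proof (induction s arbitrary: J R c)
  case Nil
  then show ?case
    by (auto simp: slot_def split: if_splits)
next
  case (Cons x s)
  note st = decode_step [OF Cons.prems]
  have "c \<notin> R"
    using Cons.prems(1) by (auto simp: slot_def)
  then show ?case
    using Cons.IH [OF st(4-6)] st(5) Cons.prems(2) insert_Diff [OF st(7)] by auto
qed

text \<open>The graft of \<open>c\<close> is invisible to the later symbols, so only the first
  symbol must be compared: \<open>c\<close> is a block minimum exactly if its host is empty, and it
  joins 1 exactly if the number is 0.\<close>

lemma encode_route:
  "slot J R c \<Longrightarrow> card R = length s \<Longrightarrow> admissible J s \<Longrightarrow>
    encode (decode c R s) (route c R s) = s"
proof (induction s arbitrary: J R c)
  case (Cons x s)
  note st = decode_step [OF Cons.prems]
  note g = graft_step [OF Cons.prems(1) st(1-3,8)]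
  define y where "y = pick R x"
  define \<pi> where "\<pi> = decode y (R - {y}) s"
  define B where "B = host \<pi> y x"
  define r where "r = route y (R - {y}) s"
  have R: "c \<notin> R" "finite R" "1 \<in> R" "0 \<notin> R"
    using Cons.prems(1) st(1) by (auto simp: slot_def)
  have y: "y \<in> R" "rank R y = max 1 (bound x)"
    using pick [of R x] R st by (auto simp: y_def)
  have p: "partition_on R \<pi>" and B: "B \<in> \<pi> \<or> B = {}" "\<And>z. z \<in> B \<Longrightarrow> z < c"
    using g by (auto simp: \<pi>_def B_def y_def)
  have f: "fits (bound x) (R - {y}) y \<pi>"
    using st(8) by (simp add: \<pi>_def y_def)
  have BR: "B \<subseteq> R"
    using B p by (auto simp: partition_on_def)
  have d: "decode c R (x # s) = graft c B \<pi>"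
    by (simp add: Let_def \<pi>_def B_def y_def)
  have bl: "block (graft c B \<pi>) z = (if z \<in> insert c B then insert c B else block \<pi> z)" if "z \<in> insert c R" for z
    by (rule block_graft [OF p R(1) B(1) that])
  have blB: "block \<pi> z = B" if "z \<in> B" for z
    using B that block_eq [OF p] by auto
  have r: "set r = R" "r \<noteq> []" "hd r = y"
    using route_props [OF st(4-6)] y by (auto simp: r_def y_def [symmetric] insert_absorb)
  have fB: "finite B"
    using BR R finite_subset by blast
  have tail: "encode (graft c B \<pi>) r = encode \<pi> r"
  proof (rule encode_cong)
    fix z assume "z \<in> set r"
    then have z: "z \<in> R" "z \<noteq> c" using r R by auto
    show "Min (block (graft c B \<pi>) z) = z \<longleftrightarrow> Min (block \<pi> z) = z"
    proof (cases "z \<in> B")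
      case True
      then have "Min B < c" "B \<noteq> {}"
        using B(2) fB Min_in by blast+
      then have "Min (insert c B) = Min B"
        using fB by (simp add: Min_insert)
      then show ?thesis
        using True bl blB z by auto
    qed (use bl z in auto)
    show "z \<in> block (graft c B \<pi>) 1 \<longleftrightarrow> z \<in> block \<pi> 1"
      using bl [of 1] blB [of 1] R z by auto
  qed
  \<comment> \<open>For a positive number \<open>j\<close> the rank of \<open>y\<close> is
    \<open>max 1 j = j\<close>.\<close>
  have h: "(if Min (block (graft c B \<pi>) c) = c then None
     else if c \<in> block (graft c B \<pi>) 1 then Some 0 else Some (rank R y)) = x"
  proof (cases x)
    case None
    then show ?thesis
      using bl [of c] by (auto simp: B_def)
  next
    case (Some j)
    have "B \<noteq> {}" 
      using Some block_mem [OF p] R y by (auto simp: B_def)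
    then have "Min B < c" "Min (insert c B) = min c (Min B)"
      using B(2) fB by (auto simp: Min_insert)
    then have m: "Min (block (graft c B \<pi>) c) \<noteq> c"
      using bl [of c] by auto
    show ?thesis
    proof (cases "j = 0")
      case True
      then have "1 \<in> B"
        using Some block_mem [OF p R(3)] by (simp add: B_def)
      then show ?thesis
        using bl [of 1] True Some m R by auto
    next
      case False
      then have "1 \<notin> B"
        using f Some by (auto simp: fits_def B_def)
      moreover have "1 \<noteq> c" using R by auto
      moreover have "c \<notin> block \<pi> 1"
        using block_subset [OF p R(3)] R by auto
      ultimately show ?thesis
        using bl [of 1] False Some m R y by auto
    qed
  qed
  obtain r' where r': "r = y # r'"
    using r by (cases r) auto
  have "route c R (x # s) = c # y # r'"
    using r' by (simp add: r_def y_def)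
  then have "encode (decode c R (x # s)) (route c R (x # s)) = x # encode \<pi> r"
    using tail r(1) unfolding d r' by (simp only: encode.simps h)
  moreover have "encode \<pi> r = s"
    using Cons.IH [OF st(4-6)] by (simp add: \<pi>_def r_def y_def)
  ultimately show ?case by simp
qed simp

text \<open>
  In a partial state \<open>c\<close> need not be the maximum, so its block has to be moved to the end of the
  order word by hand.
\<close>

lemma rev_route:
  "slot J R c \<Longrightarrow> card R = length s \<Longrightarrow> admissible J s \<Longrightarrow> \<pi> = decode c R s \<Longrightarrow>
    rev (route c R s) = (if 1 \<in> block \<pi> c then order_word \<pi>
      else order_word (\<pi> - {block \<pi> c}) @ sorted_list_of_set (block \<pi> c))"
proof (induction s arbitrary: J R c \<pi>)
  case Nil
  then have c: "c = 1" "\<pi> = {{1}}"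
    by (auto simp: slot_def split: if_splits)
  have "partition_on {1} {{1::nat}}"
    by (simp add: partition_on_def disjoint_def)
  then have "block \<pi> 1 = {1}"
    using c block_eq by auto
  then show ?case
    using c by (simp add: order_word_def order_skeleton_def)
next
  case (Cons x s)
  note st = decode_step [OF Cons.prems(1-3)]
  note g = graft_step [OF Cons.prems(1) st(1-3,8)]
  define y where "y = pick R x"
  define \<rho> where "\<rho> = decode y (R - {y}) s"
  define B where "B = host \<rho> y x"
  have R: "c \<notin> R" "finite R" "1 \<in> R" "0 \<notin> R" "c \<noteq> 1"
    using Cons.prems(1) st(1) by (auto simp: slot_def)
  have y: "y \<in> R"
    using st by (auto simp: y_def)
  have p: "partition_on R \<rho>" and B: "B \<in> \<rho> \<or> B = {}" "\<And>z. z \<in> B \<Longrightarrow> z < c"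
    using g by (auto simp: \<rho>_def B_def y_def)
  have f: "fits (bound x) (R - {y}) y \<rho>"
    using st(8) by (simp add: \<rho>_def y_def)
  have BR: "B \<subseteq> R"
    using B p by (auto simp: partition_on_def)
  have \<pi>: "\<pi> = graft c B \<rho>"
    using Cons.prems(4) by (simp add: Let_def \<rho>_def B_def y_def)
  have blc: "block \<pi> c = insert c B"
    unfolding \<pi> using block_graft [OF p R(1) B(1)] by simp
  have df: "\<pi> - {insert c B} = \<rho> - {B}"
    unfolding \<pi> by (rule graft_Diff [OF p R(1)])
  have IH: "rev (route c R (x # s)) = (if 1 \<in> block \<rho> y then order_word \<rho>
      else order_word (\<rho> - {block \<rho> y}) @ sorted_list_of_set (block \<rho> y)) @ [c]"
    using Cons.IH [OF st(4-6) refl] by (simp add: \<rho>_def y_def)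
  \<comment> \<open>Here \<open>y\<close> is the maximum of \<open>R\<close>, so its block already
    stands last in \<open>order_word \<rho>\<close> and both branches of the induction hypothesis
    agree.\<close>
  have top: "rev (route c R (x # s)) = order_word \<rho> @ [c]" if "bound x = 0"
    unfolding IH using order_word_last_block [OF p R(2,3) y] pick_greatest [OF R(2) that]
    by (auto simp: y_def)
  show ?case
  proof (cases x)
    case None
    then have "B = {}"
      by (simp add: B_def)
    moreover have "\<rho> - {{}} = \<rho>"
      using p by (auto simp: partition_on_def)
    ultimately show ?thesis
      using top None R df by (simp add: blc)
  next
    case (Some j)
    show ?thesis
    proof (cases "j = 0")
      case True
      then have "B = block \<rho> 1" "1 \<in> B"
        using Some block_mem [OF p R(3)] by (simp_all add: B_def)
      moreover have "\<And>z. z \<in> R \<Longrightarrow> z < c"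
        using Cons.prems(1) st(3) Some True slot_greatest by auto
      ultimately show ?thesis
        using top True Some order_word_graft_greatest [OF p R(2,3)] by (simp add: blc) (simp add: \<pi>)
    next
      case False
      then have "B = block \<rho> y" "1 \<notin> B"
        using Some f by (auto simp: B_def fits_def)
      moreover have "sorted_list_of_set (insert c B) = sorted_list_of_set B @ [c]"
        by (rule sorted_list_of_set_insert_greatest) (use B BR R finite_subset in auto)
      ultimately show ?thesis
        using IH R df by (simp add: blc)
    qed
  qed
qed

section \<open>The letters of a partition in terms of its symbols\<close>

lemma nth_image_drop: "(!) xs ` {m..<length xs} = set (drop m xs)"
proof -
  have "set (drop m xs) = (\<lambda>i. xs ! (m + i)) ` {..<length xs - m}"
    by (auto simp: set_conv_nth)
  also have "\<dots> = (!) xs ` ((+) m ` {0..<length xs - m})"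
    by (simp only: image_image lessThan_atLeast0)
  also have "(+) m ` {0..<length xs - m} = {m..<length xs}"
    by (cases "m \<le> length xs") auto
  finally show ?thesis by simp
qed

text \<open>The prefix of \<open>w\<close> ending at index \<open>i\<close> holds the current
  element and the unread ones. Both \<open>level\<close> and \<open>letters\<close> raise the level
  exactly when the current element is not a block minimum.\<close>

lemma letters_encode:
  assumes w: "w = order_word \<pi>" "distinct w" "length w = Suc n" "set w = {1..Suc n}"
  shows "i \<le> n \<Longrightarrow> admissible J (encode \<pi> (rev (take (Suc i) w))) \<Longrightarrow>
    map (word_letter n \<pi>) (rev [1..<Suc i]) = letters (level n \<pi> i) (encode \<pi> (rev (take (Suc i) w)))"
proof (induction i arbitrary: J)
  case 0
  have "take 1 w = [w ! 0]"
    using w by (simp add: take_Suc_conv_app_nth)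
  then show ?case by simp
next
  case (Suc i)
  define r where "r = rev (take (Suc i) w)"
  define T where "T = set (take (Suc i) w)"
  have oe: "order_elem \<pi> k = w ! k" for k
    by (simp add: order_elem_def w)
  have r: "r = w ! i # rev (take i w)" "set r = T" "length r = Suc i"
    using Suc.prems w by (auto simp: r_def T_def take_Suc_conv_app_nth)
  have rS: "rev (take (Suc (Suc i)) w) = w ! Suc i # r"
    using Suc.prems w by (simp add: r_def take_Suc_conv_app_nth)
  have lev: "level n \<pi> i = (if smallest \<pi> (w ! Suc i) = w ! Suc i
      then level n \<pi> (Suc i) else Suc (level n \<pi> (Suc i)))"
    using Suc.prems by (subst level.simps) (simp add: oe)
  define h where "h = (if Min (block \<pi> (w ! Suc i)) = w ! Suc i then None
     else if w ! Suc i \<in> block \<pi> 1 then Some 0 else Some (rank T (w ! i)))"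
  have enc: "encode \<pi> (rev (take (Suc (Suc i)) w)) = h # encode \<pi> r"
    unfolding rS using r by (simp add: h_def)
  have adm: "admissible (bound h) (encode \<pi> r)" "bound h \<le> i"
    using Suc.prems(2) r unfolding enc by (auto simp: admissible_Cons)
  have IH: "map (word_letter n \<pi>) (rev [1..<Suc i]) = letters (level n \<pi> i) (encode \<pi> r)"
    using Suc.IH adm(1) Suc.prems by (simp add: r_def)
  \<comment> \<open>\<open>largest\<close> ranks within the unread elements without 1, whereas
    \<open>encode\<close> keeps 1. The ranks agree because 1 is the smallest element and
    \<open>w ! i\<close> is not 1.\<close>
  have the: "(THE j. j \<in> {1..card ({2..n+1} - order_elem \<pi> ` {Suc i..n})}
      \<and> largest n \<pi> (Suc i) j = order_elem \<pi> i) = rank T (w ! i)" if hT: "h = Some (rank T (w ! i))"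
  proof -
    have "set w = T \<union> (!) w ` {Suc i..n}" "T \<inter> (!) w ` {Suc i..n} = {}"
    proof -
      have img: "(!) w ` {Suc i..n} = set (drop (Suc i) w)"
        using nth_image_drop [of w "Suc i"] w(3) by (simp add: atLeastLessThanSuc_atLeastAtMost)
      show "set w = T \<union> (!) w ` {Suc i..n}"
        unfolding img T_def set_append [symmetric] append_take_drop_id ..
      show "T \<inter> (!) w ` {Suc i..n} = {}"
        unfolding img T_def by (rule set_take_disj_set_drop_if_distinct [OF w(2) order_refl])
    qed
    moreover have "{2..n+1} = set w - {1}"
      unfolding w(4) by auto
    moreover have "order_elem \<pi> ` {Suc i..n} = (!) w ` {Suc i..n}"
      by (simp add: oe)
    ultimately have S: "{2..n+1} - order_elem \<pi> ` {Suc i..n} = T - {1}"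
      by blast
    have T: "finite T" "w ! i \<in> T" "card T = Suc i" "T \<subseteq> {1..Suc n}"
    proof -
      show "finite T" by (simp add: T_def)
      show "w ! i \<in> T" using r by force
      show "card T = Suc i"
        using r w by (metis T_def distinct_card distinct_take length_rev r_def)
      show "T \<subseteq> {1..Suc n}"
        using w set_take_subset unfolding T_def by metis
    qed
    have "{z \<in> T. 1 \<le> z} = T"
      using T by auto
    then have "rank T 1 = Suc i"
      using T by (simp add: rank_def)
    \<comment> \<open>Admissibility bounds this number by \<open>i\<close>, whereas 1 has rank
      \<open>Suc i\<close>.\<close>
    then have w1: "w ! i \<noteq> 1"
      using adm(2) hT by auto
    then have "1 < w ! i"
      using T by (metis atLeastAtMost_iff le_neq_implies_less subsetD)
    then have "{z \<in> T - {1}. w ! i \<le> z} = {z \<in> T. w ! i \<le> z}"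
      by auto
    then have rk: "rank (T - {1}) (w ! i) = rank T (w ! i)"
      by (simp add: rank_def)
    have mem: "w ! i \<in> T - {1}" and fin: "finite (T - {1})"
      using T w1 by auto
    have "rank (T - {1}) (w ! i) \<in> {1..card (T - {1})}"
      using rank_image [OF fin] mem by blast
    then show ?thesis
      unfolding largest_def S oe
      using sorted_nth_eq_iff_rank [OF fin mem] rk by (intro the_equality) auto
  qed
  have "word_letter n \<pi> (Suc i) # letters (level n \<pi> i) (encode \<pi> r)
      = letters (level n \<pi> (Suc i)) (h # encode \<pi> r)"
    using the lev r unfolding word_letter_def h_def by (auto simp: oe smallest_def)
  then show ?case
    using IH enc by simp
qed

section \<open>Complete sequences and the bijection\<close>

lemma slot_start: "slot 0 {1..n} (Suc n)"
  by (auto simp: slot_def)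

lemma partition_word_decode:
  assumes "length s = n" "admissible 0 s"
  shows "partition_word n (decode (Suc n) {1..n} s) = letters 0 s"
proof -
  define \<pi> where "\<pi> = decode (Suc n) {1..n} s"
  define w where "w = order_word \<pi>"
  have c: "card {1..n} = length s"
    using assms by simp
  have i: "insert (Suc n) {1..n} = {1..Suc n}"
    by auto
  have p: "partition_on {1..Suc n} \<pi>"
    using decode_fits [OF slot_start c assms(2)] unfolding fits_def i \<pi>_def by blast
  \<comment> \<open>In the complete state \<open>Suc n\<close> is the maximum, so
    \<open>order_word_last_block\<close> makes both cases of \<open>rev_route\<close> the order
    word.\<close>
  have rw: "rev (route (Suc n) {1..n} s) = w"
    using rev_route [OF slot_start c assms(2) \<pi>_def] order_word_last_block [OF p, of "Suc n"]
    by (auto simp: w_def split: if_splits)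
  have "distinct w" "length w = Suc n" "set w = {1..Suc n}"
    using route_props [OF slot_start c assms(2)] unfolding rw [symmetric] i by auto
  moreover have enc: "encode \<pi> (rev w) = s"
    using encode_route [OF slot_start c assms(2)] by (simp add: rw [symmetric] \<pi>_def)
  ultimately have "map (word_letter n \<pi>) (rev [1..<Suc n]) = letters (level n \<pi> n) s"
    using letters_encode [OF w_def, of n n 0] assms by simp
  moreover have "level n \<pi> n = 0"
    by (subst level.simps) simp
  ultimately show ?thesis
    by (simp add: partition_word_def \<pi>_def)
qed

lemma Partitions_iff:
  assumes "k \<le> n"
  shows "\<pi> \<in> Partitions (n + 1) (n - k + 1) \<longleftrightarrow>
    (\<exists>s. length s = n \<and> admissible 0 s \<and> falls s = k \<and> \<pi> = decode (Suc n) {1..n} s)"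
proof -
  have i: "insert (Suc n) {1..n} = {1..n + 1}"
    by auto
  \<comment> \<open>For \<open>J = 0\<close> and \<open>c\<close> the overall maximum, the invariant
    reduces to being a partition.\<close>
  have fits: "fits 0 {1..n} (Suc n) \<pi> \<longleftrightarrow> partition_on {1..n + 1} \<pi>"
    using block_subset [of "{1..n + 1}" \<pi> "Suc n"] unfolding fits_def i by fastforce
  have crd: "card (decode (Suc n) {1..n} s) + falls s = Suc n" if "length s = n" "admissible 0 s" for s
    using card_decode [OF slot_start _ that(2), of n] that by simp
  show ?thesis
  proof
    assume "\<pi> \<in> Partitions (n + 1) (n - k + 1)"
    then have "fits 0 {1..n} (Suc n) \<pi>" "card \<pi> = n - k + 1"
      using fits by (auto simp: Partitions_def)
    moreover from this obtain s where "length s = n" "admissible 0 s" "decode (Suc n) {1..n} s = \<pi>"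
      using decode_surj [OF slot_start] by auto
    ultimately show "\<exists>s. length s = n \<and> admissible 0 s \<and> falls s = k \<and> \<pi> = decode (Suc n) {1..n} s"
      using crd [of s] assms by (intro exI [of _ s]) auto
  next
    assume "\<exists>s. length s = n \<and> admissible 0 s \<and> falls s = k \<and> \<pi> = decode (Suc n) {1..n} s"
    then obtain s where s: "length s = n" "admissible 0 s" "falls s = k" "\<pi> = decode (Suc n) {1..n} s"
      by blast
    then have "fits 0 {1..n} (Suc n) \<pi>"
      using decode_fits [OF slot_start _ s(2), of n] by simp
    then show "\<pi> \<in> Partitions (n + 1) (n - k + 1)"
      using fits crd [OF s(1,2)] s assms by (auto simp: Partitions_def)
  qed
qed

theorem theorem3p5:
  fixes n k :: nat
  assumes "k \<le> n"
  shows "(\<forall>\<pi> \<in> Partitions (n + 1) (n - k + 1).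
            \<exists>!p. p \<in> Paths n k \<and> path_word p = partition_word n \<pi>)
         \<and> bij_betw (Phi n k) (Partitions (n + 1) (n - k + 1)) (Paths n k)"
proof -
  let ?\<Pi> = "Partitions (n + 1) (n - k + 1)"
  \<comment> \<open>Both partitions are decoded from codes; equal words give equal codes by
    \<open>letters_inject\<close>, hence equal partitions.\<close>
  have inj_word: "inj_on (partition_word n) ?\<Pi>"
    by (intro inj_onI) (metis Partitions_iff [OF assms] partition_word_decode letters_inject)
  have ex1: "\<exists>!p. p \<in> Paths n k \<and> path_word p = partition_word n \<pi>" if \<pi>: "\<pi> \<in> ?\<Pi>" for \<pi>
  proof -
    obtain s where s: "length s = n" "admissible 0 s" "falls s = k" "\<pi> = decode (Suc n) {1..n} s"
      using \<pi> Partitions_iff [OF assms] by blast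
    then obtain p where "p \<in> Paths n k" "path_word p = partition_word n \<pi>"
      using walk_complete [OF state_source, of s n] partition_word_decode
      by (auto simp: Paths_iff_walk)
    then show ?thesis
      using walk_unique [OF _ _ state_source] by (metis Paths_iff_walk)
  qed
  then have Phi: "Phi n k \<pi> \<in> Paths n k" "path_word (Phi n k \<pi>) = partition_word n \<pi>"
    if "\<pi> \<in> ?\<Pi>" for \<pi>
    unfolding Phi_def using theI' [OF ex1 [OF that]] by blast+
  have "inj_on (Phi n k) ?\<Pi>"
    using Phi(2) inj_word by (metis inj_on_def)
  \<comment> \<open>The code read along \<open>p\<close> decodes to a partition with the same word,
    and uniqueness of the path with that word identifies its image with \<open>p\<close>.\<close>
  moreover have "p \<in> Phi n k ` ?\<Pi>" if p: "p \<in> Paths n k" for p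
  proof -
    obtain s where s: "length s = n" "admissible 0 s" "path_word p = letters 0 s" "k = falls s"
      using walk_sound [OF _ state_source, of k p n] p by (auto simp: Paths_iff_walk)
    define \<pi> where "\<pi> = decode (Suc n) {1..n} s"
    have \<pi>: "\<pi> \<in> ?\<Pi>"
      using s Partitions_iff [OF assms] \<pi>_def by blast
    moreover have "path_word p = partition_word n \<pi>"
      using s(3) partition_word_decode [OF s(1,2)] by (simp only: \<pi>_def)
    ultimately show ?thesis
      using ex1 [OF \<pi>] Phi [OF \<pi>] p by blast
  qed
  ultimately show ?thesis
    using ex1 Phi by (auto simp: bij_betw_def)
qed

end
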